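(* Let $n=2m$ be even. For $w\in W(D_n)$ we have $$\mathcal{G}^{D}_{n,w}(a,b;x)=\sum_{\mathbf{D}\in {\rm Rsub}(\Delta^D_n,w)} Wt^{D}_n(\mathbf{D}),\qquad Wt^D_n(\mathbf{D})=\prod_{\Box\in \mathbf{D}} wt^D_n(\Box)\times\prod_{\bigcirc\in B(\mathbf{D})}\bigl(1+\beta\, wt^D_n(\bigcirc)\bigr),$$ where the first product is over the entries of the subsequence $\mathbf{D}$ and the second over the elements of $B(\mathbf{D})$. For odd $n=2m-1$, $\mathcal{G}^{D}_{n,w}(a,b;x)$ is obtained from this formula for the even rank $2m$ (viewing $w\in W(D_{2m-1})\subset W(D_{2m})$) by setting $x_{2m}=0$.
   Context: Let $\beta$ be an indeterminate, $x\oplus y:=x+y+\beta xy$ and $\bar{x}:=-x/(1+\beta x)$. $W(D_n)$ is the type $D_n$ Weyl group generated by $s_{\hat{1}},s_1,\ldots,s_{n-1}$ (where $s_{\hat 1}=s_0s_1s_0$ inside the hyperoctahedral group). The idCoxeter algebra ${\rm Id}_\beta(W)$ is the $\mathbb{Z}[\beta]$-algebra with generators $u_i$ ($s_i$ a simple reflection), relations $u_i^2=\beta u_i$ and the braid relations of $W$; $u_w:=u_{i_1}\cdots u_{i_\ell}$ for a reduced word $w=s_{i_1}\cdots s_{i_\ell}$, and these form a basis. Put $h_i(x)=1+xu_i$, $A^{(n)}_i(x)=h_{n-1}(x)h_{n-2}(x)\cdots h_i(x)$, $G_{A_{n-1}}(a_1,\ldots,a_{n-1})=A^{(n)}_1(a_1)A^{(n)}_2(a_2)\cdots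 A^{(n)}_{n-1}(a_{n-1})$, $F^D_n(x)=h_{n-1}(x)\cdots h_2(x)h_1(x)h_{\hat 1}(x)h_2(x)\cdots h_{n-1}(x)$ and $F^D_n(x_1,\ldots,x_n)=\prod_{i=1}^n F^D_n(x_i)$. The double Grothendieck polynomial $\mathcal{G}^D_{n,w}(a,b;x)$ is the coefficient of $u_w$ in $G_{A_{n-1}}(\bar b_1,\ldots,\bar b_{n-1})^{-1}F^D_n(x_1,\ldots,x_n)G_{A_{n-1}}(a_1,\ldots,a_{n-1})$. The Demazure product is defined by $w\star v=z$ iff $u_wu_v=\beta^{\ell(w)+\ell(v)-\ell(z)}u_z$. For a sequence $\Delta=(d_1,\ldots,d_N)$ of simple reflections and $w$ of length $\ell$, ${\rm Rsub}(\Delta,w)$ is the set of subsequences $(d_{j_1},\ldots,d_{j_\ell})$, $1\le j_1<\cdots<j_\ell\le N$, with $d_{j_1}\cdots d_{j_\ell}=w$ (reduced words of $w$); for such $\mathbf{D}$, with $j_{\ell+1}:=N+1$, $B(\mathbf{D})$ is the set of $d_j$ ($j\le N$) such that for some $p$ with $j_p<j<j_{p+1}$ one has $(d_{j_1}\cdots d_{j_p})\star d_j=d_{j_1}\cdots d_{j_p}$. For $n=2m$, $\Delta^D_n:=\Delta^A_{n-1}\,\bigl((s_{\hat 1},s_2,\ldots,s_{n-1})(s_1,s_2,\ldots,s_{n-1})\bigr)^m=(d_1,\ldots,d_N)$, where $\Delta^A_{n-1}=(s_{n-1}\,|\,s_{n-2},s_{n-1}\,|\,\cdots\,|\,s_1,s_2,\ldots,s_{n-1})$.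 Coordinates: for $1\le k\le n(n-1)/2$, if $m'(m'-1)/2<k\le m'(m'+1)/2$ then $d_k$ has coordinate $(k-m'(m'-1)/2,\,2n-m')$; the remaining $n(n-1)$ entries are placed in rows $j=n,n-1,\ldots,1$, row $j$ containing coordinates $(i,j)$ for $i=n+2-j,\ldots,2n-j$ from left to right (i.e. the trapezoid from $(1,2n-1)$ to $(2n-1,1)$ with the positions $(i,n+1-i)$, $1\le i\le n$, skipped). Set $p_i=x_{n+1-i}$ for $1\le i\le n$, $p_i=a_{i-n}$ for $i>n$, $q_j=x_j$ for $1\le j\le n$, $q_j=b_{j-n}$ for $j>n$, and $wt^D_n(d_k)=p_i\oplus q_j$ if $d_k$ has coordinate $(i,j)$. *)

theory Defs
  imports
    "HOL-Algebra.QuotRing"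
    "HOL-Combinatorics.Transposition"
    "HOL-Library.Poly_Mapping"
    "HOL-Computational_Algebra.Polynomial_Factorial"
begin

section \<open>The Weyl group of type D\<close>

text \<open>
  Signed permutations are odd bijections of the integers, fixing all but finitely many points;
  thus the inclusion of the group of rank \<open>n\<close> into that of rank \<open>n + 1\<close> is set inclusion.
  The generator \<open>Hat\<close> stands for \<open>s\<^sub>0 s\<^sub>1 s\<^sub>0\<close>, and \<open>S i\<close> for \<open>s\<^sub>i\<close> with \<open>i \<ge> 1\<close>.
  The rank \<open>n\<close> is at least 2 throughout, since \<open>s\<^sub>0 s\<^sub>1 s\<^sub>0\<close> involves \<open>s\<^sub>1\<close>.
\<close>

datatype gen = Hat | S nat

definition refl_B :: "nat \<Rightarrow> int \<Rightarrow> int" where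
  "refl_B i =
     (if i = 0 then transpose 1 (- 1)
      else transpose (int i) (int i + 1) \<circ> transpose (- int i) (- (int i + 1)))"

fun simple_refl :: "gen \<Rightarrow> int \<Rightarrow> int" where
  "simple_refl Hat = refl_B 0 \<circ> refl_B 1 \<circ> refl_B 0"
| "simple_refl (S i) = refl_B i"

definition gens_D :: "nat \<Rightarrow> gen set" where
  "gens_D n = insert Hat (S ` {1..<n})"

definition word_prod :: "gen list \<Rightarrow> int \<Rightarrow> int" where
  "word_prod ds = foldr (\<lambda>d w. simple_refl d \<circ> w) ds id"

text \<open>The generators are involutions, so words in them already exhaust the generated group.\<close>

definition W_D :: "nat \<Rightarrow> (int \<Rightarrow> int) set" where
  "W_D n = {word_prod ds | ds. set ds \<subseteq> gens_D n}"

definition len_D :: "nat \<Rightarrow> (int \<Rightarrow> int) \<Rightarrow> nat" where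
  "len_D n w = (LEAST k. \<exists>ds. set ds \<subseteq> gens_D n \<and> length ds = k \<and> word_prod ds = w)"

definition reduced_word :: "nat \<Rightarrow> (int \<Rightarrow> int) \<Rightarrow> gen list \<Rightarrow> bool" where
  "reduced_word n w ds \<longleftrightarrow>
     set ds \<subseteq> gens_D n \<and> word_prod ds = w \<and> length ds = len_D n w"

definition coxeter_m :: "gen \<Rightarrow> gen \<Rightarrow> nat" where
  "coxeter_m s t = (LEAST k. 0 < k \<and> (simple_refl s \<circ> simple_refl t) ^^ k = id)"


section \<open>The idCoxeter algebra\<close>

text \<open>
  The free associative algebra consists of the finitely supported functions on the free monoid,
  with convolution as multiplication. \<open>Poly_Mapping\<close> wants the monoid written additively.
\<close>

datatype 'g free_word = FreeWord (letters: "'g list")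

instantiation free_word :: (type) monoid_add
begin

definition "0 = FreeWord []"

definition "v + w = FreeWord (letters v @ letters w)"

instance
  by standard (simp_all add: zero_free_word_def plus_free_word_def)

end

definition free_alg :: "nat \<Rightarrow> (gen free_word \<Rightarrow>\<^sub>0 'r::comm_ring_1) ring" where
  "free_alg n =
     \<lparr>carrier = {p. \<forall>v \<in> Poly_Mapping.keys p. set (letters v) \<subseteq> gens_D n},
      monoid.mult = (*), one = 1, zero = 0, add = (+)\<rparr>"

definition monomial :: "gen list \<Rightarrow> gen free_word \<Rightarrow>\<^sub>0 'r::comm_ring_1" where
  "monomial ds = Poly_Mapping.single (FreeWord ds) 1"

definition const :: "'r \<Rightarrow> gen free_word \<Rightarrow>\<^sub>0 'r::comm_ring_1" where
  "const c = Poly_Mapping.single 0 c"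

definition alternating :: "gen \<Rightarrow> gen \<Rightarrow> nat \<Rightarrow> gen list" where
  "alternating s t k = map (\<lambda>i. if even i then s else t) [0..<k]"

definition relators :: "'r \<Rightarrow> nat \<Rightarrow> (gen free_word \<Rightarrow>\<^sub>0 'r::comm_ring_1) set" where
  "relators \<beta> n =
     {monomial [s, s] - const \<beta> * monomial [s] | s. s \<in> gens_D n} \<union>
     {monomial (alternating s t (coxeter_m s t)) - monomial (alternating t s (coxeter_m s t)) | s t.
        s \<in> gens_D n \<and> t \<in> gens_D n \<and> s \<noteq> t}"

definition rel_ideal :: "'r \<Rightarrow> nat \<Rightarrow> (gen free_word \<Rightarrow>\<^sub>0 'r::comm_ring_1) set" where
  "rel_ideal \<beta> n = genideal (free_alg n) (relators \<beta> n)"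

text \<open>Coefficients are taken in an arbitrary commutative ring with a chosen element \<open>\<beta>\<close>:
  this is the base change of the algebra over the polynomial ring in \<open>\<beta>\<close>.\<close>

definition id_cox :: "'r \<Rightarrow> nat \<Rightarrow> (gen free_word \<Rightarrow>\<^sub>0 'r::comm_ring_1) set ring" where
  "id_cox \<beta> n = free_alg n Quot rel_ideal \<beta> n"

definition cls :: "'r \<Rightarrow> nat \<Rightarrow> (gen free_word \<Rightarrow>\<^sub>0 'r::comm_ring_1) \<Rightarrow> (gen free_word \<Rightarrow>\<^sub>0 'r) set" where
  "cls \<beta> n p = rel_ideal \<beta> n +>\<^bsub>free_alg n\<^esub> p"

definition u_elt :: "'r \<Rightarrow> nat \<Rightarrow> (int \<Rightarrow> int) \<Rightarrow> (gen free_word \<Rightarrow>\<^sub>0 'r::comm_ring_1) set" where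
  "u_elt \<beta> n w = cls \<beta> n (monomial (SOME ds. reduced_word n w ds))"

definition smult_u ::
  "'r \<Rightarrow> nat \<Rightarrow> 'r \<Rightarrow> (int \<Rightarrow> int) \<Rightarrow> (gen free_word \<Rightarrow>\<^sub>0 'r::comm_ring_1) set" where
  "smult_u \<beta> n c w = cls \<beta> n (const c) \<otimes>\<^bsub>id_cox \<beta> n\<^esub> u_elt \<beta> n w"

text \<open>The elements \<open>u\<^sub>w\<close> form a basis, so the description determines the coefficients.\<close>

definition u_coeff ::
  "'r \<Rightarrow> nat \<Rightarrow> (gen free_word \<Rightarrow>\<^sub>0 'r::comm_ring_1) set \<Rightarrow> (int \<Rightarrow> int) \<Rightarrow> 'r" where
  "u_coeff \<beta> n z =
     (THE c. (\<forall>w. w \<notin> W_D n \<longrightarrow> c w = 0) \<and>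
             z = (\<Oplus>\<^bsub>id_cox \<beta> n\<^esub>w\<in>W_D n. smult_u \<beta> n (c w) w))"

text \<open>\<open>demazure \<beta> n w v z\<close> says that \<open>w \<star> v = z\<close>.\<close>

definition demazure ::
  "'r::comm_ring_1 \<Rightarrow> nat \<Rightarrow> (int \<Rightarrow> int) \<Rightarrow> (int \<Rightarrow> int) \<Rightarrow> (int \<Rightarrow> int) \<Rightarrow> bool" where
  "demazure \<beta> n w v z \<longleftrightarrow>
     z \<in> W_D n \<and> len_D n z \<le> len_D n w + len_D n v \<and>
     u_elt \<beta> n w \<otimes>\<^bsub>id_cox \<beta> n\<^esub> u_elt \<beta> n v =
       smult_u \<beta> n (\<beta> ^ (len_D n w + len_D n v - len_D n z)) z"


section \<open>Double Grothendieck polynomials of type D\<close>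

definition fg_add :: "'r::comm_ring_1 \<Rightarrow> 'r \<Rightarrow> 'r \<Rightarrow> 'r" where
  "fg_add \<beta> x y = x + y + \<beta> * x * y"

definition fg_neg :: "'r::field \<Rightarrow> 'r \<Rightarrow> 'r" where
  "fg_neg \<beta> x = - x / (1 + \<beta> * x)"

definition list_prod :: "('e, 'm) ring_scheme \<Rightarrow> 'e list \<Rightarrow> 'e" where
  "list_prod R es = foldr (\<lambda>e f. e \<otimes>\<^bsub>R\<^esub> f) es \<one>\<^bsub>R\<^esub>"

definition h_elt :: "'r \<Rightarrow> nat \<Rightarrow> gen \<Rightarrow> 'r \<Rightarrow> (gen free_word \<Rightarrow>\<^sub>0 'r::comm_ring_1) set" where
  "h_elt \<beta> n s x =
     \<one>\<^bsub>id_cox \<beta> n\<^esub> \<oplus>\<^bsub>id_cox \<beta> n\<^esub>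
     (cls \<beta> n (const x) \<otimes>\<^bsub>id_cox \<beta> n\<^esub> cls \<beta> n (monomial [s]))"

definition A_elt :: "'r \<Rightarrow> nat \<Rightarrow> nat \<Rightarrow> 'r \<Rightarrow> (gen free_word \<Rightarrow>\<^sub>0 'r::comm_ring_1) set" where
  "A_elt \<beta> n i x = list_prod (id_cox \<beta> n) (map (\<lambda>k. h_elt \<beta> n (S k) x) (rev [i..<n]))"

definition G_A :: "'r \<Rightarrow> nat \<Rightarrow> (nat \<Rightarrow> 'r) \<Rightarrow> (gen free_word \<Rightarrow>\<^sub>0 'r::comm_ring_1) set" where
  "G_A \<beta> n a = list_prod (id_cox \<beta> n) (map (\<lambda>i. A_elt \<beta> n i (a i)) [1..<n])"

definition F_D1 :: "'r \<Rightarrow> nat \<Rightarrow> 'r \<Rightarrow> (gen free_word \<Rightarrow>\<^sub>0 'r::comm_ring_1) set" where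
  "F_D1 \<beta> n x =
     list_prod (id_cox \<beta> n)
       (map (\<lambda>s. h_elt \<beta> n s x) (map S (rev [1..<n]) @ [Hat] @ map S [2..<n]))"

definition F_D :: "'r \<Rightarrow> nat \<Rightarrow> (nat \<Rightarrow> 'r) \<Rightarrow> (gen free_word \<Rightarrow>\<^sub>0 'r::comm_ring_1) set" where
  "F_D \<beta> n x = list_prod (id_cox \<beta> n) (map (\<lambda>i. F_D1 \<beta> n (x i)) [1..<n+1])"

definition double_groth_D ::
  "'r::field \<Rightarrow> nat \<Rightarrow> (int \<Rightarrow> int) \<Rightarrow> (nat \<Rightarrow> 'r) \<Rightarrow> (nat \<Rightarrow> 'r) \<Rightarrow> (nat \<Rightarrow> 'r) \<Rightarrow> 'r" where
  "double_groth_D \<beta> n w a b x =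
     u_coeff \<beta> n
       (inv\<^bsub>id_cox \<beta> n\<^esub> (G_A \<beta> n (\<lambda>i. fg_neg \<beta> (b i)))
          \<otimes>\<^bsub>id_cox \<beta> n\<^esub> F_D \<beta> n x
          \<otimes>\<^bsub>id_cox \<beta> n\<^esub> G_A \<beta> n a) w"


section \<open>Weighted subwords\<close>

definition Delta_A :: "nat \<Rightarrow> gen list" where
  "Delta_A n = concat (map (\<lambda>i. map S [i..<n]) (rev [1..<n]))"

definition Delta_D :: "nat \<Rightarrow> gen list" where
  "Delta_D n =
     Delta_A n @ concat (replicate (n div 2) (([Hat] @ map S [2..<n]) @ map S [1..<n]))"

text \<open>Entry \<open>j\<close> of this list is the coordinate of entry \<open>j\<close> of \<open>Delta_D n\<close>. The first
  \<open>n (n - 1) / 2\<close> entries are listed by blocks of length \<open>r = 1, \<dots>, n - 1\<close>.\<close>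

definition coords_D :: "nat \<Rightarrow> (nat \<times> nat) list" where
  "coords_D n =
     concat (map (\<lambda>r. map (\<lambda>i. (i, 2 * n - r)) [1..<r + 1]) [1..<n]) @
     concat (map (\<lambda>j. map (\<lambda>i. (i, j)) [n + 2 - j..<2 * n - j + 1]) (rev [1..<n + 1]))"

definition wt_D ::
  "'r::comm_ring_1 \<Rightarrow> nat \<Rightarrow> (nat \<Rightarrow> 'r) \<Rightarrow> (nat \<Rightarrow> 'r) \<Rightarrow> (nat \<Rightarrow> 'r) \<Rightarrow> nat \<Rightarrow> 'r" where
  "wt_D \<beta> n a b x k =
     (case coords_D n ! k of (i, j) \<Rightarrow>
        fg_add \<beta>
          (if i \<le> n then x (n + 1 - i) else a (i - n))
          (if j \<le> n then x j else b (j - n)))"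

text \<open>A subsequence of \<open>ds\<close> is given by its set of positions, counted from 0.\<close>

definition Rsub :: "nat \<Rightarrow> gen list \<Rightarrow> (int \<Rightarrow> int) \<Rightarrow> nat set set" where
  "Rsub n ds w =
     {J. J \<subseteq> {..<length ds} \<and> card J = len_D n w \<and> word_prod (nths ds J) = w}"

text \<open>For \<open>J = {j\<^sub>1 < j\<^sub>2 < \<dots>}\<close> and a position \<open>j\<close> strictly between \<open>j\<^sub>p\<close> and its successor in
  \<open>J\<close>, the word \<open>nths ds (J \<inter> {..<j})\<close> consists of the first \<open>p\<close> entries of the subsequence.
  Positions before \<open>j\<^sub>1\<close> never qualify, since the product of the identity with a simple
  reflection is that reflection.\<close>

definition B_set :: "'r::comm_ring_1 \<Rightarrow> nat \<Rightarrow> gen list \<Rightarrow> nat set \<Rightarrow> nat set" where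
  "B_set \<beta> n ds J =
     {j. j < length ds \<and> j \<notin> J \<and>
         demazure \<beta> n (word_prod (nths ds (J \<inter> {..<j}))) (simple_refl (ds ! j))
           (word_prod (nths ds (J \<inter> {..<j})))}"

definition Wt_D ::
  "'r::comm_ring_1 \<Rightarrow> nat \<Rightarrow> (nat \<Rightarrow> 'r) \<Rightarrow> (nat \<Rightarrow> 'r) \<Rightarrow> (nat \<Rightarrow> 'r) \<Rightarrow> nat set \<Rightarrow> 'r" where
  "Wt_D \<beta> n a b x J =
     (\<Prod>k\<in>J. wt_D \<beta> n a b x k) *
     (\<Prod>k\<in>B_set \<beta> n (Delta_D n) J. 1 + \<beta> * wt_D \<beta> n a b x k)"


section \<open>The indeterminates\<close>

datatype var = Beta | VarA nat | VarB nat | VarX nat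

text \<open>An arbitrary linear order on the variables is needed only for the \<open>idom\<close> instance
  of the polynomial ring.\<close>

fun var_code :: "var \<Rightarrow> nat" where
  "var_code Beta = 0"
| "var_code (VarA i) = 3 * i + 1"
| "var_code (VarB i) = 3 * i + 2"
| "var_code (VarX i) = 3 * i + 3"

lemma var_code_inject: "var_code v = var_code w \<Longrightarrow> v = w"
  by (cases v; cases w; simp; presburger)

instantiation var :: linorder
begin

definition "v \<le> w \<longleftrightarrow> var_code v \<le> var_code w"

definition "v < w \<longleftrightarrow> var_code v < var_code w"

instance
  by standard (auto simp: less_eq_var_def less_var_def intro: var_code_inject)

end

text \<open>The fraction field of the integral polynomial ring in all the indeterminates.\<close>

type_synonym ratfun = "((var \<Rightarrow>\<^sub>0 nat) \<Rightarrow>\<^sub>0 int) fract"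

definition indet :: "var \<Rightarrow> ratfun" where
  "indet v = to_fract (Poly_Mapping.single (Poly_Mapping.single v 1) 1)"

definition beta_var :: ratfun where
  "beta_var = indet Beta"

definition a_var :: "nat \<Rightarrow> ratfun" where
  "a_var i = indet (VarA i)"

definition b_var :: "nat \<Rightarrow> ratfun" where
  "b_var i = indet (VarB i)"

definition x_var :: "nat \<Rightarrow> ratfun" where
  "x_var i = indet (VarX i)"

end

(*
  The free algebra acts on functions on signed permutations: u_s sends f to the function whose value
  at w is f(w s) if w s is longer than w, and beta f(w) otherwise. This action factors through the
  idCoxeter algebra, and by Matsumoto's theorem the coefficient of u_w in z is the value at the
  identity of z applied to the indicator function of w. All identities of products of factors h_i can
  therefore be checked on these operators.

  Type A factors satisfy the Yang-Baxter equation, hence (with u = h_1(b) ... h_{n-1}(b))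
    u G(y_1, ..., y_{n-1}) = G'(y_1, ..., y_{n-2}) h_1(y_1 + b) ... h_{n-1}(y_{n-1} + b),
  where + is the formal group law and G' lives on s_2, ..., s_{n-1}. Since h_1 and h_Hat commute,
  F(x) can be split as a decreasing product starting the G of one of the two branches, times an
  increasing product through the other; so F(x_j) G(x_{j-1}, ..., x_1, a_1, ...) splits off one row of
  the diagram and leaves G(x_j, ..., x_1, a_1, ...) for the other branch. Applying this to
  F(x_n) ... F(x_1) G(a), which requires that the F(x_i) commute (a reflection equation), and then
  the same identity to G(bar b)^{-1} G(x_n, ..., x_2), gives the product of all h(wt(d_k)).
  Expanding that product from left to right yields the sum over reduced subwords. For odd rank,
  F(0) = 1 and the coefficients at W(D_{2m-1}) do not see the factors h_{2m-1}.
*)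
theory Submission
  imports Defs "HOL-Combinatorics.Permutations"
begin

section \<open>Signed permutations and ascents\<close>


text \<open>A linear functional f on the algebra is recorded by its values f(w) on u_w, and u_s
  sends f to z \<mapsto> f(z u_s). This is transposed right multiplication, so a product p q acts as
  p after q. One module settles two points: evaluation at the identity separates the u_w, and
  equalities in a quotient by a generated ideal become equalities of functions. The functions live
  on all signed permutations, not on a group of fixed rank, so that ranks n and n + 1 can be
  compared on the same operators.

  The parity of n enters through the branches. Each absorbed F(x_j) switches G between the branch
  through s_1 and the one through s_Hat. The type A factor on the left knows only s_1, ..., s_{n-1},
  so after n switches the initial branch must be back: n is even. The skipped positions of the
  trapezoid have the same origin: row j is split off before x_j joins the parameters, so x_j is
  never paired with itself.\<close>

definition signed_perm :: "(int \<Rightarrow> int) \<Rightarrow> bool" where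
  "signed_perm w \<longleftrightarrow> bij w \<and> (\<forall>k. w (- k) = - w k)"

text \<open>For odd \<open>w\<close> the condition at \<open>Hat\<close> says w(1) + w(2) > 0.
  Written with the positions -1 and 2, it lets \<open>Hat\<close> and \<open>S 2\<close> act like
  consecutive transpositions on -1, 2, 3, which \<open>adj_chain\<close> exploits.\<close>

definition ascent :: "gen \<Rightarrow> (int \<Rightarrow> int) \<Rightarrow> bool" where
  "ascent s w \<longleftrightarrow> (case s of Hat \<Rightarrow> w (- 1) < w 2 | S i \<Rightarrow> w (int i) < w (int i + 1))"

text \<open>\<open>S 0\<close> is a value of the datatype and denotes the sign change of 1, which
  lies outside type D.\<close>

definition valid :: "gen \<Rightarrow> bool" where
  "valid s \<longleftrightarrow> s \<noteq> S 0"

definition adj :: "gen \<Rightarrow> gen \<Rightarrow> bool" where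
  "adj s t \<longleftrightarrow> valid s \<and> valid t \<and>
    (case (s, t) of
       (Hat, Hat) \<Rightarrow> False
     | (Hat, S i) \<Rightarrow> i = 2
     | (S i, Hat) \<Rightarrow> i = 2
     | (S i, S j) \<Rightarrow> i = Suc j \<or> j = Suc i)"

definition far :: "gen \<Rightarrow> gen \<Rightarrow> bool" where
  "far s t \<longleftrightarrow> valid s \<and> valid t \<and> s \<noteq> t \<and> \<not> adj s t"

lemma adj_sym: "adj s t \<Longrightarrow> adj t s"
  by (auto simp: adj_def split: gen.splits)

lemma far_sym: "far s t \<Longrightarrow> far t s"
  using adj_sym by (auto simp: far_def)

lemma adj_valid: "adj s t \<Longrightarrow> valid s \<and> valid t"
  by (simp add: adj_def)

lemma far_valid: "far s t \<Longrightarrow> valid s \<and> valid t"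
  by (simp add: far_def)

lemma adj_simps:
  "adj (S i) (S j) \<longleftrightarrow> 0 < i \<and> 0 < j \<and> (i = Suc j \<or> j = Suc i)"
  "adj Hat (S i) \<longleftrightarrow> i = 2"
  "adj (S i) Hat \<longleftrightarrow> i = 2"
  "\<not> adj Hat Hat"
  by (auto simp: adj_def valid_def)

lemma far_simps:
  "far (S i) (S j) \<longleftrightarrow> 0 < i \<and> 0 < j \<and> i \<noteq> j \<and> i \<noteq> Suc j \<and> j \<noteq> Suc i"
  "far Hat (S i) \<longleftrightarrow> 0 < i \<and> i \<noteq> 2"
  "far (S i) Hat \<longleftrightarrow> 0 < i \<and> i \<noteq> 2"
  "\<not> far Hat Hat"
  by (auto simp: far_def adj_simps valid_def)

lemma adj_or_far: "valid s \<Longrightarrow> valid t \<Longrightarrow> s \<noteq> t \<Longrightarrow> adj s t \<or> far s t"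
  by (auto simp: far_def)

lemma gens_D_valid: "s \<in> gens_D n \<Longrightarrow> valid s"
  by (auto simp: gens_D_def valid_def)

lemma simple_refl_S:
  assumes "i > 0"
  shows "simple_refl (S i) k =
    (if k = int i then int i + 1 else if k = int i + 1 then int i
     else if k = - int i then - int i - 1 else if k = - int i - 1 then - int i else k)"
  using assms by (auto simp: refl_B_def transpose_def)

lemma simple_refl_Hat:
  "simple_refl Hat k =
    (if k = 1 then -2 else if k = 2 then -1 else if k = -1 then 2 else if k = -2 then 1 else k)"
  by (auto simp: refl_B_def transpose_def)

lemmas refl_simps = simple_refl_S simple_refl_Hat

declare simple_refl.simps [simp del]

lemma simple_refl_involution [simp]: "valid s \<Longrightarrow> simple_refl s (simple_refl s k) = k"
  by (cases s) (auto simp: valid_def refl_simps)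

lemma simple_refl_comp_self [simp]: "valid s \<Longrightarrow> simple_refl s \<circ> simple_refl s = id"
  by (rule ext) simp

lemma comp_simple_refl_twice [simp]: "valid s \<Longrightarrow> w \<circ> simple_refl s \<circ> simple_refl s = w"
  by (rule ext) simp

lemma signed_perm_simple_refl: "valid s \<Longrightarrow> signed_perm (simple_refl s)"
  unfolding signed_perm_def
proof
  assume "valid s"
  then show "bij (simple_refl s)"
    by (intro o_bij[where g = "simple_refl s"]) auto
  show "\<forall>k. simple_refl s (- k) = - simple_refl s k"
    using \<open>valid s\<close> by (cases s) (auto simp: valid_def refl_simps)
qed

lemma signed_perm_id [simp]: "signed_perm id"
  by (simp add: signed_perm_def)

lemma signed_perm_comp: "signed_perm v \<Longrightarrow> signed_perm w \<Longrightarrow> signed_perm (v \<circ> w)"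
  by (simp add: signed_perm_def bij_comp)

lemma signed_perm_comp_simple_refl [simp]:
  "valid s \<Longrightarrow> signed_perm (w \<circ> simple_refl s) \<longleftrightarrow> signed_perm w"
  using signed_perm_comp[of "w \<circ> simple_refl s" "simple_refl s"]
    signed_perm_comp[of w "simple_refl s"] signed_perm_simple_refl[of s]
  by auto

lemma signed_perm_eq_iff [simp]: "signed_perm w \<Longrightarrow> w i = w j \<longleftrightarrow> i = j"
  by (auto simp: signed_perm_def bij_def inj_eq)

lemma ascent_comp_self:
  "valid s \<Longrightarrow> signed_perm w \<Longrightarrow> ascent s (w \<circ> simple_refl s) \<longleftrightarrow> \<not> ascent s w"
  by (cases s) (auto simp: ascent_def refl_simps valid_def order_le_less linorder_not_less)

lemma ascent_id: "valid s \<Longrightarrow> ascent s id"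
  by (cases s) (auto simp: ascent_def)

lemma ascent_comp_far:
  "far s t \<Longrightarrow> signed_perm w \<Longrightarrow> ascent s (w \<circ> simple_refl t) \<longleftrightarrow> ascent s w"
  by (cases s; cases t) (auto simp: ascent_def refl_simps far_simps signed_perm_def)

text \<open>The two ends of an edge of the Dynkin diagram act on three positions and their negatives
  by two consecutive transpositions, in one of two orders. Claims about a braid pair thereby become
  claims about the order of three values, without a case split on \<open>Hat\<close>.\<close>

lemma adj_chain:
  assumes "adj s t"
  obtains (up) p q r where "\<And>w. ascent s w \<longleftrightarrow> w p < w q" "\<And>w. ascent t w \<longleftrightarrow> w q < w r"
     "simple_refl s p = q" "simple_refl s q = p" "simple_refl s r = r"
     "simple_refl t p = p" "simple_refl t q = r" "simple_refl t r = q" "p \<noteq> q" "q \<noteq> r" "p \<noteq> r"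
  | (down) p q r where "\<And>w. ascent t w \<longleftrightarrow> w p < w q" "\<And>w. ascent s w \<longleftrightarrow> w q < w r"
     "simple_refl t p = q" "simple_refl t q = p" "simple_refl t r = r"
     "simple_refl s p = p" "simple_refl s q = r" "simple_refl s r = q" "p \<noteq> q" "q \<noteq> r" "p \<noteq> r"
proof (cases s)
  case Hat
  then have "t = S 2" using assms by (cases t) (auto simp: adj_simps)
  then show ?thesis using Hat by (intro up[of "-1" 2 3]) (auto simp: ascent_def refl_simps)
next
  case (S i)
  show ?thesis
  proof (cases t)
    case Hat
    then have "i = 2" using assms S by (auto simp: adj_simps)
    then show ?thesis using S Hat by (intro down[of "-1" 2 3]) (auto simp: ascent_def refl_simps)
  next
    fix j assume t: "t = S j"
    then consider "j = Suc i" "i > 0" | "i = Suc j" "j > 0" using assms S by (auto simp: adj_simps)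
    then show ?thesis
    proof cases
      case 1
      then show ?thesis using S t
        by (intro up[of "int i" "int i + 1" "int i + 2"]) (auto simp: ascent_def refl_simps add.commute)
    next
      case 2
      then show ?thesis using S t
        by (intro down[of "int j" "int j + 1" "int j + 2"]) (auto simp: ascent_def refl_simps add.commute)
    qed
  qed
qed

text \<open>Two descents put the three values of \<open>adj_chain\<close> in decreasing order, so
  that three successive shortening steps are available.\<close>

lemma ascent_adj_descents:
  assumes "adj s t" "signed_perm w" "\<not> ascent s w" "\<not> ascent t w"
  shows "\<not> ascent t (w \<circ> simple_refl s)" "\<not> ascent s (w \<circ> simple_refl s \<circ> simple_refl t)"
  using assms by (auto elim!: adj_chain)

text \<open>A simple reflection reverses a single pair of values up to sign, the pair of its own
  root. Opposite values and pairs with 0 give no roots of type D: \<open>Hat\<close> also reverses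
  (-1, 1) and (0, 1), whence the exclusions.\<close>

lemma simple_refl_inversion:
  assumes "valid t" "X < Y" "X \<noteq> - Y" "X \<noteq> 0" "Y \<noteq> 0" "simple_refl t Y \<le> simple_refl t X"
  shows "simple_refl t k = (if k = X then Y else if k = Y then X else if k = - X then - Y
      else if k = - Y then - X else k)"
proof (cases t)
  case Hat
  have "(X, Y) \<in> {(-2, 1), (-1, 2)}"
    using assms(2-) unfolding Hat simple_refl_Hat by (simp split: if_splits)
  then show ?thesis
    unfolding Hat by (elim insertE emptyE) (simp_all add: simple_refl_Hat)
next
  case (S i)
  then have i: "i > 0" using assms(1) by (simp add: valid_def)
  have "(X, Y) = (int i, int i + 1) \<or> (X, Y) = (- int i - 1, - int i)"
    using assms(2-) i unfolding S simple_refl_S[OF i] by (simp split: if_splits)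
  then show ?thesis
    unfolding S simple_refl_S[OF i] using i by fastforce
qed

text \<open>Condition (C) of Bourbaki's criterion for Coxeter groups, which implies the exchange property.\<close>

lemma exchange_step:
  assumes "valid s" "valid t" "signed_perm w" "ascent s w" "\<not> ascent s (simple_refl t \<circ> w)"
  shows "w \<circ> simple_refl s = simple_refl t \<circ> w"
proof -
  define p q where "p = (case s of Hat \<Rightarrow> - 1 | S i \<Rightarrow> int i)"
    and "q = (case s of Hat \<Rightarrow> 2 | S i \<Rightarrow> int i + 1)"
  have pq: "p \<noteq> q" "p \<noteq> - q" "p \<noteq> 0" "q \<noteq> 0"
    using assms(1) by (auto simp: p_def q_def valid_def split: gen.splits)
  have s: "simple_refl s k = (if k = p then q else if k = q then p else if k = - p then - q
      else if k = - q then - p else k)" for k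
    using assms(1) by (cases s) (auto simp: p_def q_def refl_simps valid_def)
  have odd: "w (- k) = - w k" for k using assms(3) by (simp add: signed_perm_def)
  have a: "w p < w q" "simple_refl t (w p) \<ge> simple_refl t (w q)"
    using assms(4,5) by (auto simp: ascent_def p_def q_def split: gen.splits)
  have ne: "w p \<noteq> - w q" "w p \<noteq> 0" "w q \<noteq> 0"
    using pq assms(3) odd[of q] odd[of 0] signed_perm_eq_iff[of w p "- q"]
      signed_perm_eq_iff[of w p 0] signed_perm_eq_iff[of w q 0] by auto
  have t: "simple_refl t k = (if k = w p then w q else if k = w q then w p
      else if k = - w p then - w q else if k = - w q then - w p else k)" for k
    using simple_refl_inversion[OF assms(2) a(1) ne a(2)] .
  show ?thesis
  proof
    fix k
    have eq: "w k = w p \<longleftrightarrow> k = p" "w k = w q \<longleftrightarrow> k = q"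
      "w k = - w p \<longleftrightarrow> k = - p" "w k = - w q \<longleftrightarrow> k = - q"
      using assms(3) by (simp_all flip: odd)
    show "(w \<circ> simple_refl s) k = (simple_refl t \<circ> w) k"
      unfolding comp_apply s t eq by (simp add: odd)
  qed
qed

text \<open>Both Coxeter relations are read off \<open>exchange_step\<close> instead of being
  computed: here with the reflection of \<open>t\<close> as \<open>w\<close> and \<open>s\<close> on
  both sides, in the braid relation below with w = s t, which gives (s t) s = t (s t).\<close>

lemma simple_refl_far:
  assumes "far s t"
  shows "simple_refl s \<circ> simple_refl t = simple_refl t \<circ> simple_refl s"
proof -
  have "valid s" "valid t" using assms by (auto dest: far_valid)
  moreover have "ascent s (simple_refl t)"
    using ascent_comp_far[OF assms signed_perm_id] ascent_id[OF \<open>valid s\<close>] by simp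
  moreover have "\<not> ascent s (simple_refl s \<circ> simple_refl t)"
    using assms by (cases s; cases t) (auto simp: ascent_def refl_simps far_simps)
  ultimately show ?thesis
    using exchange_step signed_perm_simple_refl by metis
qed

lemma simple_refl_adj:
  assumes "adj s t"
  shows "simple_refl s \<circ> simple_refl t \<circ> simple_refl s = simple_refl t \<circ> simple_refl s \<circ> simple_refl t"
proof -
  have v: "valid s" "valid t" using assms by (auto dest: adj_valid)
  moreover have "ascent s (simple_refl s \<circ> simple_refl t)"
    "\<not> ascent s (simple_refl t \<circ> (simple_refl s \<circ> simple_refl t))"
    using assms ascent_id[OF v(1)] ascent_id[OF v(2)] by (auto elim!: adj_chain)
  ultimately show ?thesis
    using exchange_step[of s t "simple_refl s \<circ> simple_refl t"]
    by (simp add: signed_perm_simple_refl comp_assoc)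
qed

section \<open>Length function and Matsumoto's theorem\<close>


lemma word_prod_Nil [simp]: "word_prod [] = id"
  and word_prod_Cons [simp]: "word_prod (d # ds) = simple_refl d \<circ> word_prod ds"
  by (simp_all add: word_prod_def id_def)

lemma word_prod_append [simp]: "word_prod (ds @ es) = word_prod ds \<circ> word_prod es"
  by (induction ds) auto

lemma signed_perm_word_prod:
  "\<forall>d \<in> set ds. valid d \<Longrightarrow> signed_perm (word_prod ds)"
  by (induction ds) (auto intro: signed_perm_comp signed_perm_simple_refl)

text \<open>At the empty suffix \<open>s\<close> is an ascent, at the whole word it is not. Where
  this changes, \<open>exchange_step\<close> turns the appended \<open>s\<close> into a letter in
  front of the suffix, which cancels the letter already there.\<close>

lemma exchange:
  assumes "\<forall>d \<in> set ds. valid d" "valid s" "\<not> ascent s (word_prod ds)"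
  shows "\<exists>as t bs. ds = as @ t # bs \<and> word_prod ds \<circ> simple_refl s = word_prod (as @ bs)"
  using assms
proof (induction ds)
  case Nil
  then show ?case using ascent_id[of s] by (simp add: id_def)
next
  case (Cons t ds)
  show ?case
  proof (cases "ascent s (word_prod ds)")
    case True
    have "\<not> ascent s (simple_refl t \<circ> word_prod ds)"
      using Cons.prems(3) by (simp only: word_prod_Cons not_False_eq_True)
    then have "word_prod ds \<circ> simple_refl s = simple_refl t \<circ> word_prod ds"
      using exchange_step[OF _ _ signed_perm_word_prod True] Cons.prems(1,2) by simp
    then have "word_prod (t # ds) \<circ> simple_refl s = word_prod ([] @ ds)"
      using Cons.prems(1) by (simp add: comp_assoc) (simp flip: comp_assoc)
    then show ?thesis by blast
  next
    case False
    have "\<forall>d \<in> set ds. valid d" using Cons.prems(1) by simp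
    from Cons.IH[OF this Cons.prems(2) False]
    obtain as u bs where "ds = as @ u # bs" "word_prod ds \<circ> simple_refl s = word_prod (as @ bs)"
      by blast
    then have "t # ds = (t # as) @ u # bs"
      "word_prod (t # ds) \<circ> simple_refl s = word_prod ((t # as) @ bs)"
      by (auto simp: comp_assoc)
    then show ?thesis by blast
  qed
qed

section \<open>Length and reduced words in rank n\<close>

lemma word_prod_in_W_D: "set ds \<subseteq> gens_D n \<Longrightarrow> word_prod ds \<in> W_D n"
  by (auto simp: W_D_def)

lemma signed_perm_W_D: "w \<in> W_D n \<Longrightarrow> signed_perm w"
  by (auto simp: W_D_def intro!: signed_perm_word_prod gens_D_valid)

lemma W_D_comp:
  assumes "w \<in> W_D n" "s \<in> gens_D n"
  shows "w \<circ> simple_refl s \<in> W_D n"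
proof -
  obtain ds where "set ds \<subseteq> gens_D n" "w = word_prod ds" using assms(1) by (auto simp: W_D_def)
  then show ?thesis using word_prod_in_W_D[of "ds @ [s]" n] assms(2) by simp
qed

lemma id_in_W_D [simp]: "id \<in> W_D n"
  using word_prod_in_W_D[of "[]" n] by simp

lemma len_D_le: "set ds \<subseteq> gens_D n \<Longrightarrow> len_D n (word_prod ds) \<le> length ds"
  unfolding len_D_def by (rule Least_le) auto

lemma reduced_word_exists: "w \<in> W_D n \<Longrightarrow> \<exists>ds. reduced_word n w ds"
proof -
  assume "w \<in> W_D n"
  then have "\<exists>k ds. set ds \<subseteq> gens_D n \<and> length ds = k \<and> word_prod ds = w"
    by (auto simp: W_D_def)
  then have "\<exists>ds. set ds \<subseteq> gens_D n \<and> length ds = len_D n w \<and> word_prod ds = w"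
    unfolding len_D_def by (rule LeastI_ex)
  then show ?thesis by (auto simp: reduced_word_def)
qed

lemma reduced_word_in_W_D: "reduced_word n w ds \<Longrightarrow> w \<in> W_D n"
  by (auto simp: reduced_word_def W_D_def)

lemma len_D_comp_le:
  assumes "w \<in> W_D n" "s \<in> gens_D n"
  shows "len_D n (w \<circ> simple_refl s) \<le> Suc (len_D n w)"
proof -
  obtain ds where "reduced_word n w ds" using reduced_word_exists[OF assms(1)] by blast
  then show ?thesis
    using len_D_le[of "ds @ [s]" n] assms(2) by (auto simp: reduced_word_def)
qed

text \<open>\<open>exchange\<close> shortens a reduced word, and a generator changes the length by
  at most one. This ties the combinatorial \<open>ascent\<close> to \<open>len_D\<close>.\<close>

lemma len_D_descent:
  assumes "w \<in> W_D n" "s \<in> gens_D n" "\<not> ascent s w"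
  shows "len_D n w = Suc (len_D n (w \<circ> simple_refl s))"
proof -
  have v: "valid s" using assms(2) by (rule gens_D_valid)
  obtain ds where ds: "reduced_word n w ds" using reduced_word_exists[OF assms(1)] by blast
  then have "\<forall>d \<in> set ds. valid d" by (auto simp: reduced_word_def intro: gens_D_valid)
  with ds obtain as t bs where
    "ds = as @ t # bs" "w \<circ> simple_refl s = word_prod (as @ bs)"
    using exchange[of ds s] v assms(3) by (auto simp: reduced_word_def)
  then have "len_D n (w \<circ> simple_refl s) < len_D n w"
    using len_D_le[of "as @ bs" n] ds by (auto simp: reduced_word_def)
  moreover have "len_D n w \<le> Suc (len_D n (w \<circ> simple_refl s))"
    using len_D_comp_le[OF W_D_comp[OF assms(1,2)] assms(2)] v by simp
  ultimately show ?thesis by linarith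
qed

lemma len_D_ascent:
  assumes "w \<in> W_D n" "s \<in> gens_D n" "ascent s w"
  shows "len_D n (w \<circ> simple_refl s) = Suc (len_D n w)"
  using len_D_descent[OF W_D_comp[OF assms(1,2)] assms(2)] assms
    ascent_comp_self[OF gens_D_valid[OF assms(2)] signed_perm_W_D[OF assms(1)]]
  by (simp only: comp_simple_refl_twice[OF gens_D_valid[OF assms(2)]] simp_thms)

lemma reduced_word_snoc:
  assumes "reduced_word n w ds" "s \<in> gens_D n" "ascent s w"
  shows "reduced_word n (w \<circ> simple_refl s) (ds @ [s])"
  using assms len_D_ascent[OF reduced_word_in_W_D[OF assms(1)] assms(2,3)]
  by (auto simp: reduced_word_def)

lemma reduced_word_snocD:
  assumes "reduced_word n w (ds @ [s])"
  shows "s \<in> gens_D n" "reduced_word n (w \<circ> simple_refl s) ds" "\<not> ascent s w"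
proof -
  show s: "s \<in> gens_D n" using assms by (simp add: reduced_word_def)
  have w: "w = word_prod ds \<circ> simple_refl s" and ds: "set ds \<subseteq> gens_D n"
    using assms by (auto simp: reduced_word_def)
  have W: "word_prod ds \<in> W_D n" using ds by (rule word_prod_in_W_D)
  have ws: "w \<circ> simple_refl s = word_prod ds"
    using gens_D_valid[OF s] by (simp add: w)
  have l: "len_D n (word_prod ds) \<le> length ds" "len_D n w = Suc (length ds)"
    using len_D_le[OF ds] assms by (auto simp: reduced_word_def)
  then show "\<not> ascent s w"
    using len_D_ascent[OF reduced_word_in_W_D[OF assms] s] by (auto simp: ws)
  then show "reduced_word n (w \<circ> simple_refl s) ds"
    using len_D_descent[OF reduced_word_in_W_D[OF assms] s] l ds ws
    by (auto simp: reduced_word_def)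
qed

lemma descent_reduced_word:
  assumes "w \<in> W_D n" "s \<in> gens_D n" "\<not> ascent s w" "reduced_word n (w \<circ> simple_refl s) ds"
  shows "reduced_word n w (ds @ [s])"
  using assms len_D_descent[OF assms(1-3)] gens_D_valid[OF assms(2)]
  by (auto simp: reduced_word_def)

text \<open>Moves act at the right end only; \<open>braid_snoc\<close> carries them to the interior.
  This fits an induction that strips last letters. Symmetry needs no rule of its own, as
  \<open>far\<close> and \<open>adj\<close> are symmetric.\<close>

inductive braid_eq :: "nat \<Rightarrow> gen list \<Rightarrow> gen list \<Rightarrow> bool" for n where
  braid_refl: "braid_eq n ds ds"
| braid_trans: "braid_eq n ds es \<Longrightarrow> braid_eq n es fs \<Longrightarrow> braid_eq n ds fs"
| braid_snoc: "braid_eq n ds es \<Longrightarrow> s \<in> gens_D n \<Longrightarrow> braid_eq n (ds @ [s]) (es @ [s])"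
| braid_far: "far s t \<Longrightarrow> s \<in> gens_D n \<Longrightarrow> t \<in> gens_D n \<Longrightarrow> set ds \<subseteq> gens_D n \<Longrightarrow>
    braid_eq n (ds @ [s, t]) (ds @ [t, s])"
| braid_adj: "adj s t \<Longrightarrow> s \<in> gens_D n \<Longrightarrow> t \<in> gens_D n \<Longrightarrow> set ds \<subseteq> gens_D n \<Longrightarrow>
    braid_eq n (ds @ [s, t, s]) (ds @ [t, s, t])"

text \<open>If the last letters \<open>s\<close> and \<open>t\<close> differ, both are descents of
  \<open>w\<close>, so \<open>w\<close> has reduced words ending in the two sides of the relation
  between \<open>s\<close> and \<open>t\<close>, with a common prefix \<open>cs\<close>. The
  induction hypothesis links each given word to the one with the same last letter, and one braid
  move joins these two.\<close>

theorem matsumoto: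
  "reduced_word n w ds \<Longrightarrow> reduced_word n w es \<Longrightarrow> braid_eq n ds es"
proof (induction "length ds" arbitrary: w ds es)
  case 0
  then have "ds = []" "es = []" unfolding reduced_word_def by (metis length_0_conv)+
  then show ?case by (simp add: braid_refl)
next
  case (Suc k)
  note IH = Suc.hyps(1)
  have len: "length es = length ds" using Suc.prems by (simp add: reduced_word_def)
  obtain as s where ds: "ds = as @ [s]" using Suc.hyps(2) by (cases ds rule: rev_cases) auto
  obtain bs t where es: "es = bs @ [t]" using Suc.hyps(2) len by (cases es rule: rev_cases) auto
  note s = reduced_word_snocD[OF Suc.prems(1)[unfolded ds]]
  note t = reduced_word_snocD[OF Suc.prems(2)[unfolded es]]
  have k: "k = length as" "k = length bs" using Suc.hyps(2) len ds es by auto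
  have W: "w \<in> W_D n" using Suc.prems(1) by (rule reduced_word_in_W_D)
  have sp: "signed_perm w" using W by (rule signed_perm_W_D)
  have v: "valid s" "valid t" using s(1) t(1) gens_D_valid by auto
  consider "s = t" | "far s t" | "adj s t" using adj_or_far[OF v] by blast
  then show ?case
  proof cases
    case 1
    then show ?thesis using IH[OF k(1) s(2)] s t by (auto simp: ds es intro: braid_snoc)
  next
    case 2
    have ws: "w \<circ> simple_refl s \<in> W_D n" and wt: "w \<circ> simple_refl t \<in> W_D n"
      using W s(1) t(1) by (auto intro: W_D_comp)
    have *: "w \<circ> simple_refl s \<circ> simple_refl t = w \<circ> simple_refl t \<circ> simple_refl s"
      using simple_refl_far[OF 2] by (simp add: comp_assoc)
    obtain cs where cs: "reduced_word n (w \<circ> simple_refl s \<circ> simple_refl t) cs"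
      using reduced_word_exists[OF W_D_comp[OF ws t(1)]] by blast
    have "\<not> ascent t (w \<circ> simple_refl s)" "\<not> ascent s (w \<circ> simple_refl t)"
      using s(3) t(3) ascent_comp_far[OF 2 sp] ascent_comp_far[OF far_sym[OF 2] sp] by auto
    then have "reduced_word n (w \<circ> simple_refl s) (cs @ [t])"
      "reduced_word n (w \<circ> simple_refl t) (cs @ [s])"
      using descent_reduced_word[OF ws t(1)] descent_reduced_word[OF wt s(1)] cs by (auto simp: *)
    then have "braid_eq n as (cs @ [t])" "braid_eq n (cs @ [s]) bs"
      using IH[OF k(1) s(2)] IH[of "cs @ [s]", OF _ _ t(2)] k s(2) t(2)
      by (auto simp: reduced_word_def)
    then have "braid_eq n ds (cs @ [t, s])" "braid_eq n (cs @ [s, t]) es"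
      using braid_snoc[of n as "cs @ [t]" s] braid_snoc[of n "cs @ [s]" bs t] s(1) t(1)
      by (auto simp: ds es)
    moreover have "braid_eq n (cs @ [t, s]) (cs @ [s, t])"
      using cs far_sym[OF 2] s(1) t(1) by (auto simp: reduced_word_def intro: braid_far)
    ultimately show ?thesis by (meson braid_trans)
  next
    case 3
    define ws wst wt wts v where "ws = w \<circ> simple_refl s" and "wst = ws \<circ> simple_refl t"
      and "wt = w \<circ> simple_refl t" and "wts = wt \<circ> simple_refl s" and "v = wst \<circ> simple_refl s"
    note defs = ws_def wst_def wt_def wts_def v_def
    have W': "ws \<in> W_D n" "wst \<in> W_D n" "wt \<in> W_D n" "wts \<in> W_D n" "v \<in> W_D n"
      using W s(1) t(1) by (auto simp: defs intro!: W_D_comp)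
    have v': "v = wts \<circ> simple_refl t"
      using simple_refl_adj[OF 3] by (simp add: defs comp_assoc)
    obtain cs where cs: "reduced_word n v cs" using reduced_word_exists[OF W'(5)] by blast
    have d: "\<not> ascent t ws" "\<not> ascent s wst" "\<not> ascent s wt" "\<not> ascent t wts"
      using ascent_adj_descents[OF 3 sp s(3) t(3)] ascent_adj_descents[OF adj_sym[OF 3] sp t(3) s(3)]
      by (auto simp: defs)
    have "reduced_word n wst (cs @ [s])"
      by (rule descent_reduced_word[OF W'(2) s(1) d(2)]) (use cs v_def in simp)
    then have A: "reduced_word n ws (cs @ [s, t])"
      using descent_reduced_word[OF W'(1) t(1) d(1), of "cs @ [s]"] by (simp add: wst_def)
    have "reduced_word n wts (cs @ [t])"
      by (rule descent_reduced_word[OF W'(4) t(1) d(4)]) (use cs v' in simp)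
    then have B: "reduced_word n wt (cs @ [t, s])"
      using descent_reduced_word[OF W'(3) s(1) d(3), of "cs @ [t]"] by (simp add: wts_def)
    have "length (cs @ [t, s]) = k"
      using B t(2) k by (simp add: reduced_word_def wt_def)
    then have "braid_eq n as (cs @ [s, t])" "braid_eq n (cs @ [t, s]) bs"
      using IH[OF k(1) s(2)] IH[of "cs @ [t, s]", OF _ _ t(2)] A B by (auto simp: ws_def wt_def)
    then have "braid_eq n ds (cs @ [s, t, s])" "braid_eq n (cs @ [t, s, t]) es"
      using braid_snoc[of n as "cs @ [s, t]" s] braid_snoc[of n "cs @ [t, s]" bs t] s(1) t(1)
      by (auto simp: ds es)
    moreover have "braid_eq n (cs @ [s, t, s]) (cs @ [t, s, t])"
      using cs 3 s(1) t(1) by (auto simp: reduced_word_def intro: braid_adj)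
    ultimately show ?thesis by (meson braid_trans)
  qed
qed

lemma reduced_word_simple_refl:
  assumes "s \<in> gens_D n"
  shows "reduced_word n (simple_refl s) [s]"
  using reduced_word_snoc[of n id "[]" s] len_D_le[of "[]" n] assms ascent_id[OF gens_D_valid[OF assms]]
  by (auto simp: reduced_word_def)

lemma permutes_W_D:
  assumes "w \<in> W_D n" "n \<ge> 2"
  shows "w permutes {- int n..int n}"
proof -
  have s: "simple_refl s permutes {- int n..int n}" if "s \<in> gens_D n" for s
  proof -
    have "simple_refl s k = k" if "k \<notin> {- int n..int n}" for k
      using that \<open>s \<in> gens_D n\<close> assms(2) by (auto simp: gens_D_def refl_simps)
    moreover have "bij (simple_refl s)"
      using signed_perm_simple_refl[OF gens_D_valid[OF that]] by (simp add: signed_perm_def)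
    ultimately show ?thesis by (auto simp: permutes_def bij_iff)
  qed
  obtain ds where "set ds \<subseteq> gens_D n" "w = word_prod ds" using assms by (auto simp: W_D_def)
  then show ?thesis
    by (induction ds arbitrary: w) (auto intro: permutes_compose s permutes_id)
qed

lemma finite_W_D: "n \<ge> 2 \<Longrightarrow> finite (W_D n)"
  by (rule finite_subset[OF _ finite_permutations[of "{- int n..int n}"]])
    (auto dest: permutes_W_D)

section \<open>Orders of products of two generators\<close>

lemma coxeter_m_far:
  assumes "far s t"
  shows "coxeter_m s t = 2"
  unfolding coxeter_m_def
proof (rule Least_equality)
  note v = far_valid[OF assms]
  have c: "simple_refl s (simple_refl t k) = simple_refl t (simple_refl s k)" for k
    using simple_refl_far[OF assms] by (metis comp_apply)
  show "0 < (2::nat) \<and> (simple_refl s \<circ> simple_refl t) ^^ 2 = id"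
    using v by (simp add: numeral_2_eq_2 fun_eq_iff c)
  fix k :: nat
  assume k: "0 < k \<and> (simple_refl s \<circ> simple_refl t) ^^ k = id"
  have "simple_refl s \<circ> simple_refl t \<noteq> id"
  proof
    assume *: "simple_refl s \<circ> simple_refl t = id"
    have "ascent t (simple_refl s)"
      using ascent_comp_far[OF far_sym[OF assms] signed_perm_id] v ascent_id by simp
    moreover have "ascent t (simple_refl s \<circ> simple_refl t)" using * v ascent_id by simp
    ultimately show False using ascent_comp_self[of t "simple_refl s"] v signed_perm_simple_refl by auto
  qed
  then have "k \<noteq> 1" using k by auto
  then show "2 \<le> k" using k by linarith
qed

text \<open>The product is a 3-cycle on the positions of \<open>adj_chain\<close>, so
  \<open>q\<close> is moved by it and by its square.\<close>

lemma coxeter_m_adj: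
  assumes "adj s t"
  shows "coxeter_m s t = 3"
  unfolding coxeter_m_def
proof (rule Least_equality)
  note v = adj_valid[OF assms]
  have c: "simple_refl s (simple_refl t (simple_refl s k)) = simple_refl t (simple_refl s (simple_refl t k))" for k
    using simple_refl_adj[OF assms] by (metis comp_apply)
  show "0 < (3::nat) \<and> (simple_refl s \<circ> simple_refl t) ^^ 3 = id"
    using v by (simp add: numeral_3_eq_3 fun_eq_iff c)
  fix k :: nat
  assume k: "0 < k \<and> (simple_refl s \<circ> simple_refl t) ^^ k = id"
  have "simple_refl s \<circ> simple_refl t \<noteq> id \<and> (simple_refl s \<circ> simple_refl t) ^^ 2 \<noteq> id"
    using assms
  proof (cases rule: adj_chain)
    case (up p q r)
    then have "(simple_refl s \<circ> simple_refl t) q \<noteq> q" "((simple_refl s \<circ> simple_refl t) ^^ 2) q \<noteq> q"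
      by (auto simp: numeral_2_eq_2)
    then show ?thesis by (metis id_apply)
  next
    case (down p q r)
    then have "(simple_refl s \<circ> simple_refl t) q \<noteq> q" "((simple_refl s \<circ> simple_refl t) ^^ 2) q \<noteq> q"
      by (auto simp: numeral_2_eq_2)
    then show ?thesis by (metis id_apply)
  qed
  then have "k \<noteq> 1" "k \<noteq> 2" using k by auto
  then show "3 \<le> k" using k by linarith
qed

section \<open>The operators and the Yang-Baxter equation\<close>


lemma fg_add_commute: "fg_add \<beta> x y = fg_add \<beta> y x"
  by (simp add: fg_add_def algebra_simps)

text \<open>Right multiplication by \<open>u\<^sub>s\<close>, transposed to functions. The value 0 outside the signed
  permutations makes the relations of the algebra hold as equations of operators.\<close>

definition uop :: "'r::comm_ring_1 \<Rightarrow> gen \<Rightarrow> ((int \<Rightarrow> int) \<Rightarrow> 'r) \<Rightarrow> (int \<Rightarrow> int) \<Rightarrow> 'r" where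
  "uop \<beta> s f w =
     (if signed_perm w then if ascent s w then f (w \<circ> simple_refl s) else \<beta> * f w else 0)"

lemma uop_plus: "uop \<beta> s (\<lambda>w. f w + g w) = (\<lambda>w. uop \<beta> s f w + uop \<beta> s g w)"
  by (auto simp: uop_def algebra_simps)

lemma uop_mult: "uop \<beta> s (\<lambda>w. c * f w) = (\<lambda>w. c * uop \<beta> s f w)"
  by (auto simp: uop_def algebra_simps)

lemma uop_uop: "valid s \<Longrightarrow> uop \<beta> s (uop \<beta> s f) = (\<lambda>w. \<beta> * uop \<beta> s f w)"
  by (rule ext) (simp add: uop_def ascent_comp_self)

lemma uop_far:
  assumes "far s t"
  shows "uop \<beta> s (uop \<beta> t f) = uop \<beta> t (uop \<beta> s f)"
  using far_valid[OF assms] simple_refl_far[OF assms]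
  by (intro ext) (simp add: uop_def ascent_comp_far[OF assms] ascent_comp_far[OF far_sym[OF assms]]
      comp_assoc)

text \<open>Both sides give \<beta>^i f(v), where v is the longest element of the coset of
  \<open>w\<close> under the two generators and i counts the inversions among the values at the
  three positions of \<open>adj_chain\<close>. For i = 0 this is the braid relation of the
  group.\<close>

lemma uop_adj:
  assumes "adj s t"
  shows "uop \<beta> s (uop \<beta> t (uop \<beta> s f)) = uop \<beta> t (uop \<beta> s (uop \<beta> t f))"
proof
  fix w :: "int \<Rightarrow> int"
  note v = adj_valid[OF assms]
  have b: "w \<circ> simple_refl s \<circ> simple_refl t \<circ> simple_refl s =
      w \<circ> simple_refl t \<circ> simple_refl s \<circ> simple_refl t"
    using simple_refl_adj[OF assms] by (simp add: comp_assoc)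
  show "uop \<beta> s (uop \<beta> t (uop \<beta> s f)) w = uop \<beta> t (uop \<beta> s (uop \<beta> t f)) w"
  proof (cases "signed_perm w")
    case True
    show ?thesis
      using assms
    proof (cases rule: adj_chain)
      case (up p q r)
      then have "w p \<noteq> w q" "w q \<noteq> w r" "w p \<noteq> w r" using True by auto
      then show ?thesis
        using v True b by (simp add: uop_def up(1-8))
    next
      case (down p q r)
      then have "w p \<noteq> w q" "w q \<noteq> w r" "w p \<noteq> w r" using True by auto
      then show ?thesis
        using v True b by (simp add: uop_def down(1-8))
    qed
  qed (simp add: uop_def)
qed

definition hop :: "'r::comm_ring_1 \<Rightarrow> gen \<Rightarrow> 'r \<Rightarrow> ((int \<Rightarrow> int) \<Rightarrow> 'r) \<Rightarrow> (int \<Rightarrow> int) \<Rightarrow> 'r" where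
  "hop \<beta> s t f = (\<lambda>w. f w + t * uop \<beta> s f w)"

lemma hop_0 [simp]: "hop \<beta> s 0 f = f"
  by (simp add: hop_def)

lemma hop_hop: "valid s \<Longrightarrow> hop \<beta> s a (hop \<beta> s b f) = hop \<beta> s (fg_add \<beta> a b) f"
  by (rule ext) (simp add: hop_def fg_add_def uop_plus uop_mult uop_uop algebra_simps)

lemma hop_far: "far s t \<Longrightarrow> hop \<beta> s a (hop \<beta> t b f) = hop \<beta> t b (hop \<beta> s a f)"
  by (rule ext) (simp add: hop_def uop_plus uop_mult uop_far[of s t] algebra_simps)

text \<open>The middle parameter is a variable with an equation, so that the rule can be used both
  with a literal \<open>fg_add\<close> in the middle (discharged by \<open>refl\<close>) and with a
  named \<open>x\<close> known to be a formal sum.\<close>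

lemma yang_baxter:
  assumes "adj s t" "c = fg_add \<beta> a b"
  shows "hop \<beta> s a (hop \<beta> t c (hop \<beta> s b f)) = hop \<beta> t b (hop \<beta> s c (hop \<beta> t a f))"
  using adj_valid[OF assms(1)]
  by (intro ext) (simp add: hop_def assms(2) fg_add_def uop_plus uop_mult uop_uop
      uop_adj[OF assms(1)] algebra_simps)

section \<open>Factorization of type A products along a chain of generators\<close>

definition hops :: "'r::comm_ring_1 \<Rightarrow> (gen \<times> 'r) list \<Rightarrow> ((int \<Rightarrow> int) \<Rightarrow> 'r) \<Rightarrow> (int \<Rightarrow> int) \<Rightarrow> 'r" where
  "hops \<beta> l f = foldr (\<lambda>(s, t). hop \<beta> s t) l f"

lemma hops_Nil [simp]: "hops \<beta> [] f = f"
  and hops_Cons [simp]: "hops \<beta> ((s, t) # l) f = hop \<beta> s t (hops \<beta> l f)"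
  and hops_append [simp]: "hops \<beta> (l @ l') f = hops \<beta> l (hops \<beta> l' f)"
  by (simp_all add: hops_def)

lemma hops_far:
  "(\<And>t b. (t, b) \<in> set l \<Longrightarrow> far s t) \<Longrightarrow> hop \<beta> s a (hops \<beta> l f) = hops \<beta> l (hop \<beta> s a f)"
  by (induction l) (force simp: hop_far)+

text \<open>A path of type A in the Dynkin diagram. The paths through \<open>S 1\<close> and through
  \<open>Hat\<close> are both instances, so the row argument is proved once for both
  branches.\<close>

fun chain :: "gen list \<Rightarrow> bool" where
  "chain [] \<longleftrightarrow> True"
| "chain [g] \<longleftrightarrow> valid g"
| "chain (g # g' # gs) \<longleftrightarrow> adj g g' \<and> (\<forall>t \<in> set gs. far g t) \<and> chain (g' # gs)"

lemma chain_tl: "chain (g # gs) \<Longrightarrow> chain gs"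
  by (cases gs) auto

definition ups :: "gen list \<Rightarrow> 'r \<Rightarrow> (gen \<times> 'r) list" where
  "ups gs b = map (\<lambda>s. (s, b)) gs"

definition downs :: "gen list \<Rightarrow> 'r \<Rightarrow> (gen \<times> 'r) list" where
  "downs gs y = map (\<lambda>s. (s, y)) (rev gs)"

lemma ups_simps [simp]: "ups [] b = []" "ups (g # gs) b = (g, b) # ups gs b"
  by (simp_all add: ups_def)

lemma downs_simps [simp]: "downs [] b = []" "downs (g # gs) b = downs gs b @ [(g, b)]"
  by (simp_all add: downs_def)

lemma in_ups_downs [simp]:
  "(s, t) \<in> set (ups gs b) \<longleftrightarrow> s \<in> set gs \<and> t = b"
  "(s, t) \<in> set (downs gs b) \<longleftrightarrow> s \<in> set gs \<and> t = b"
  by (auto simp: ups_def downs_def)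

text \<open>At the last node the two factors merge into the formal sum. Each Yang-Baxter move then
  carries the merged factor one node back, until it reaches \<open>g\<close>; the decreasing product
  comes out without \<open>g\<close>.\<close>

lemma ups_downs:
  "chain (g # gs) \<Longrightarrow>
   hops \<beta> (ups (g # gs) b) (hops \<beta> (downs (g # gs) y) f) =
   hops \<beta> (downs gs y) (hop \<beta> g (fg_add \<beta> y b) (hops \<beta> (ups gs b) f))"
proof (induction gs arbitrary: g f)
  case Nil
  then show ?case by (simp add: hop_hop fg_add_commute)
next
  case (Cons g' gs)
  then have *: "adj g g'" "\<And>t. t \<in> set gs \<Longrightarrow> far g t" "chain (g' # gs)" by auto
  have c1: "hop \<beta> g b (hops \<beta> (downs gs y) F) = hops \<beta> (downs gs y) (hop \<beta> g b F)" for F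
    by (rule hops_far) (simp add: *(2))
  have c2: "hops \<beta> (ups gs b) (hop \<beta> g y f) = hop \<beta> g y (hops \<beta> (ups gs b) f)"
    by (rule hops_far[symmetric]) (simp add: *(2))
  have "hops \<beta> (ups (g # g' # gs) b) (hops \<beta> (downs (g # g' # gs) y) f) =
    hop \<beta> g b (hops \<beta> (ups (g' # gs) b) (hops \<beta> (downs (g' # gs) y) (hop \<beta> g y f)))"
    by simp
  also have "\<dots> = hop \<beta> g b (hops \<beta> (downs gs y)
      (hop \<beta> g' (fg_add \<beta> y b) (hops \<beta> (ups gs b) (hop \<beta> g y f))))"
    by (simp only: Cons.IH[OF *(3)])
  also have "\<dots> = hops \<beta> (downs gs y)
      (hop \<beta> g b (hop \<beta> g' (fg_add \<beta> y b) (hop \<beta> g y (hops \<beta> (ups gs b) f))))"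
    by (simp only: c1 c2)
  also have "hop \<beta> g b (hop \<beta> g' (fg_add \<beta> y b) (hop \<beta> g y (hops \<beta> (ups gs b) f))) =
      hop \<beta> g' y (hop \<beta> g (fg_add \<beta> y b) (hop \<beta> g' b (hops \<beta> (ups gs b) f)))"
    by (rule yang_baxter[OF *(1) fg_add_commute])
  finally show ?case by simp
qed

text \<open>For the chain S 1, ..., S (n - 1) this is the factor list of \<open>G_A\<close>, with
  parameters counted from 0. The chain through \<open>Hat\<close> gives its twin for the other
  branch.\<close>

fun G_list :: "gen list \<Rightarrow> (nat \<Rightarrow> 'r) \<Rightarrow> (gen \<times> 'r) list" where
  "G_list [] y = []"
| "G_list (g # gs) y = downs (g # gs) (y 0) @ G_list gs (y \<circ> Suc)"

fun row_list :: "'r::comm_ring_1 \<Rightarrow> gen list \<Rightarrow> 'r \<Rightarrow> (nat \<Rightarrow> 'r) \<Rightarrow> (gen \<times> 'r) list" where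
  "row_list \<beta> [] b y = []"
| "row_list \<beta> (g # gs) b y = (g, fg_add \<beta> (y 0) b) # row_list \<beta> gs b (y \<circ> Suc)"

lemma in_G_list: "(s, t) \<in> set (G_list gs y) \<Longrightarrow> s \<in> set gs"
  by (induction gs arbitrary: y) auto

lemma ups_G_list:
  "chain gs \<Longrightarrow> hops \<beta> (ups gs b) (hops \<beta> (G_list gs y) f) =
     hops \<beta> (G_list (tl gs) y) (hops \<beta> (row_list \<beta> gs b y) f)"
proof (induction gs arbitrary: y)
  case Nil
  then show ?case by simp
next
  case (Cons g gs)
  \<comment> \<open>These factors start two nodes after \<open>g\<close>, so the merged factor at
    \<open>g\<close> passes them freely.\<close>
  have far: "far g s" if "(s, t) \<in> set (G_list (tl gs) z)" for s t z
    using Cons.prems in_G_list[OF that] by (cases gs) auto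
  have "hops \<beta> (ups (g # gs) b) (hops \<beta> (G_list (g # gs) y) f) =
    hops \<beta> (ups (g # gs) b) (hops \<beta> (downs (g # gs) (y 0)) (hops \<beta> (G_list gs (y \<circ> Suc)) f))"
    by simp
  also have "\<dots> = hops \<beta> (downs gs (y 0)) (hop \<beta> g (fg_add \<beta> (y 0) b)
      (hops \<beta> (G_list (tl gs) (y \<circ> Suc)) (hops \<beta> (row_list \<beta> gs b (y \<circ> Suc)) f)))"
    by (simp only: ups_downs[OF Cons.prems] Cons.IH[OF chain_tl[OF Cons.prems]])
  also have "\<dots> = hops \<beta> (downs gs (y 0)) (hops \<beta> (G_list (tl gs) (y \<circ> Suc))
      (hop \<beta> g (fg_add \<beta> (y 0) b) (hops \<beta> (row_list \<beta> gs b (y \<circ> Suc)) f)))"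
    using far by (subst hops_far) auto
  finally show ?case by (cases gs) simp_all
qed

text \<open>The inverse of \<open>G_list\<close> at the formal negatives of \<open>b\<close>:
  reversal turns decreasing products into increasing ones, and h(b) inverts h at the formal negative
  of b. In this form no division occurs.\<close>

fun inv_G_list :: "gen list \<Rightarrow> (nat \<Rightarrow> 'r) \<Rightarrow> (gen \<times> 'r) list" where
  "inv_G_list [] b = []"
| "inv_G_list (g # gs) b = inv_G_list gs (b \<circ> Suc) @ ups (g # gs) (b 0)"

text \<open>The chain and \<open>b\<close> are shifted from row to row, but \<open>y\<close> is not:
  \<open>ups_G_list\<close> shortens the chain of \<open>G\<close> and keeps its parameters. Hence
  every row of the triangle restarts at the first column.\<close>

fun triangle_list :: "'r::comm_ring_1 \<Rightarrow> gen list \<Rightarrow> (nat \<Rightarrow> 'r) \<Rightarrow> (nat \<Rightarrow> 'r) \<Rightarrow> (gen \<times> 'r) list" where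
  "triangle_list \<beta> [] b y = []"
| "triangle_list \<beta> (g # gs) b y = triangle_list \<beta> gs (b \<circ> Suc) y @ row_list \<beta> (g # gs) (b 0) y"

lemma inv_G_list_G_list:
  "chain gs \<Longrightarrow> hops \<beta> (inv_G_list gs b) (hops \<beta> (G_list gs y) f) =
     hops \<beta> (triangle_list \<beta> gs b y) f"
proof (induction gs arbitrary: b f)
  case (Cons g gs)
  have "hops \<beta> (inv_G_list (g # gs) b) (hops \<beta> (G_list (g # gs) y) f) =
    hops \<beta> (inv_G_list gs (b \<circ> Suc)) (hops \<beta> (ups (g # gs) (b 0)) (hops \<beta> (G_list (g # gs) y) f))"
    by simp
  also have "\<dots> = hops \<beta> (inv_G_list gs (b \<circ> Suc)) (hops \<beta> (G_list gs y)
      (hops \<beta> (row_list \<beta> (g # gs) (b 0) y) f))"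
    by (simp only: ups_G_list[OF Cons.prems] list.sel)
  finally show ?case by (simp only: Cons.IH[OF chain_tl[OF Cons.prems]] triangle_list.simps hops_append)
qed simp

section \<open>The factors F and the reflection equation\<close>

definition F_list :: "nat \<Rightarrow> 'r \<Rightarrow> (gen \<times> 'r) list" where
  "F_list n x = map (\<lambda>s. (s, x)) (map S (rev [1..<n]) @ [Hat] @ map S [2..<n])"

lemma F_list_2: "hops \<beta> (F_list 2 x) f = hop \<beta> (S 1) x (hop \<beta> Hat x f)"
  by (simp add: F_list_def numeral_2_eq_2)

lemma F_list_Suc:
  "n \<ge> 2 \<Longrightarrow> hops \<beta> (F_list (Suc n) x) f = hop \<beta> (S n) x (hops \<beta> (F_list n x) (hop \<beta> (S n) x f))"
  by (simp add: F_list_def)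

lemma F_list_far:
  assumes "m \<ge> 2" "n > m"
  shows "hop \<beta> (S n) z (hops \<beta> (F_list m x) f) = hops \<beta> (F_list m x) (hop \<beta> (S n) z f)"
  using assms by (intro hops_far) (auto simp: F_list_def far_simps)

text \<open>This is \<open>F\<^sub>n\<^sub>+\<^sub>1(x) F\<^sub>n\<^sub>+\<^sub>1(y) = F\<^sub>n\<^sub>+\<^sub>1(y) F\<^sub>n\<^sub>+\<^sub>1(x)\<close> with invertible outer factors cancelled;
  unlike the commutation itself, it can be proved by induction.\<close>

lemma reflection_equation:
  assumes "n \<ge> 2" "x = fg_add \<beta> z y"
  shows "hop \<beta> (S n) z (hops \<beta> (F_list n x) (hop \<beta> (S n) (fg_add \<beta> x y) (hops \<beta> (F_list n y) f))) =
    hops \<beta> (F_list n y) (hop \<beta> (S n) (fg_add \<beta> x y) (hops \<beta> (F_list n x) (hop \<beta> (S n) z f)))"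
  using assms(1)
proof (induction n arbitrary: f rule: nat_induct_at_least)
  case base
  note yb = yang_baxter[where \<beta> = \<beta>]
  let ?c = "fg_add \<beta> x y"
  have adj: "adj (S 2) (S 1)" "adj (S 1) (S 2)" "adj Hat (S 2)" "adj (S 2) Hat"
    by (simp_all add: adj_simps)
  have far: "far (S 1) Hat" by (simp add: far_simps)
  note comm = hop_far[OF far]
  have "hop \<beta> (S 2) z (hop \<beta> (S 1) x (hop \<beta> Hat x (hop \<beta> (S 2) ?c (hop \<beta> (S 1) y (hop \<beta> Hat y f))))) =
    hop \<beta> (S 2) z (hop \<beta> (S 1) x (hop \<beta> Hat x (hop \<beta> (S 2) ?c (hop \<beta> Hat y (hop \<beta> (S 1) y f)))))"
    by (simp only: comm)
  also have "\<dots> = hop \<beta> (S 2) z (hop \<beta> (S 1) x (hop \<beta> (S 2) y (hop \<beta> Hat ?c (hop \<beta> (S 2) x (hop \<beta> (S 1) y f)))))"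
    by (simp only: yb[OF adj(3) refl])
  also have "\<dots> = hop \<beta> (S 1) y (hop \<beta> (S 2) x (hop \<beta> (S 1) z (hop \<beta> Hat ?c (hop \<beta> (S 2) x (hop \<beta> (S 1) y f)))))"
    by (simp only: yb[OF adj(1) assms(2)])
  also have "\<dots> = hop \<beta> (S 1) y (hop \<beta> (S 2) x (hop \<beta> Hat ?c (hop \<beta> (S 1) z (hop \<beta> (S 2) x (hop \<beta> (S 1) y f)))))"
    by (simp only: comm)
  also have "\<dots> = hop \<beta> (S 1) y (hop \<beta> (S 2) x (hop \<beta> Hat ?c (hop \<beta> (S 2) y (hop \<beta> (S 1) x (hop \<beta> (S 2) z f)))))"
    by (simp only: yb[OF adj(2) assms(2)])
  also have "\<dots> = hop \<beta> (S 1) y (hop \<beta> Hat y (hop \<beta> (S 2) ?c (hop \<beta> Hat x (hop \<beta> (S 1) x (hop \<beta> (S 2) z f)))))"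
    by (simp only: yb[OF adj(4) refl])
  finally show ?case by (simp only: F_list_2 comm)
next
  case (Suc n)
  note yb = yang_baxter[where \<beta> = \<beta>]
  let ?c = "fg_add \<beta> x y"
  let ?h = "hop \<beta> (S (Suc n))" and ?h' = "hop \<beta> (S n)" and ?F = "\<lambda>x. hops \<beta> (F_list n x)"
  have n: "n \<ge> 2" by fact
  have adj: "adj (S n) (S (Suc n))" "adj (S (Suc n)) (S n)" using n by (auto simp: adj_simps)
  have comm: "?h a (?F b g) = ?F b (?h a g)" for a b g by (rule F_list_far) (use n in auto)
  \<comment> \<open>Two Yang-Baxter moves and commutations produce the pattern h(z) F(x) h(c) F(y)
    at level \<open>n\<close>, where the induction hypothesis applies. Two further moves restore the
    outer factors in the opposite order.\<close>
  have "?h z (?h' x (?F x (?h' x (?h ?c (?h' y (?F y (?h' y f))))))) =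
        ?h z (?h' x (?F x (?h y (?h' ?c (?h x (?F y (?h' y f)))))))"
    by (simp only: yb[OF adj(1) refl])
  also have "\<dots> = ?h z (?h' x (?h y (?F x (?h' ?c (?F y (?h x (?h' y f)))))))"
    by (simp only: comm)
  also have "\<dots> = ?h' y (?h x (?h' z (?F x (?h' ?c (?F y (?h x (?h' y f)))))))"
    by (simp only: yb[OF adj(2) assms(2)])
  also have "\<dots> = ?h' y (?h x (?F y (?h' ?c (?F x (?h' z (?h x (?h' y f)))))))"
    by (simp only: Suc.IH)
  also have "\<dots> = ?h' y (?h x (?F y (?h' ?c (?F x (?h y (?h' x (?h z f)))))))"
    by (simp only: yb[OF adj(1) assms(2)])
  also have "\<dots> = ?h' y (?F y (?h x (?h' ?c (?h y (?F x (?h' x (?h z f)))))))"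
    by (simp only: comm)
  also have "\<dots> = ?h' y (?F y (?h' y (?h ?c (?h' x (?F x (?h' x (?h z f)))))))"
    by (simp only: yb[OF adj(2) refl])
  finally show ?case by (simp only: F_list_Suc[OF n])
qed

text \<open>The formal difference \<open>z\<close> of \<open>x\<close> and \<open>y\<close> is a parameter to avoid division.\<close>

lemma F_list_commute:
  assumes "n \<ge> 2" "x = fg_add \<beta> z y"
  shows "hops \<beta> (F_list n x) (hops \<beta> (F_list n y) f) = hops \<beta> (F_list n y) (hops \<beta> (F_list n x) f)"
  using assms(1)
proof (cases n rule: nat.exhaust)
  case (Suc k)
  show ?thesis
  proof (cases "k \<ge> 2")
    case False
    then have [simp]: "n = 2" using assms(1) Suc by simp
    have far: "far (S 1) Hat" by (simp add: far_simps)
    have v: "valid (S 1)" "valid Hat" by (simp_all add: valid_def)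
    show ?thesis
      by (simp add: F_list_2 hop_far[OF far, symmetric] hop_hop[OF v(1)] hop_hop[OF v(2)]
          fg_add_commute[of \<beta> x y] del: One_nat_def) 
  next
    case True
    let ?h = "hop \<beta> (S k)" and ?F = "\<lambda>x. hops \<beta> (F_list k x)"
    have v: "valid (S k)" using True by (simp add: valid_def)
    have hh: "?h a (?h b g) = ?h (fg_add \<beta> a b) g" for a b g by (rule hop_hop[OF v])
    \<comment> \<open>As x is the formal sum of z and y, the leftmost factor splits as h(y) h(z),
      which exposes the left side of the reflection equation.\<close>
    have "?h x (?F x (?h x (?h y (?F y (?h y f))))) =
        ?h y (?h z (?F x (?h (fg_add \<beta> x y) (?F y (?h y f)))))"
      by (simp only: hh assms(2) fg_add_commute[of \<beta> z y])
    also have "\<dots> = ?h y (?F y (?h (fg_add \<beta> x y) (?F x (?h z (?h y f)))))"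
      by (simp only: reflection_equation[OF True assms(2)])
    also have "\<dots> = ?h y (?F y (?h y (?h x (?F x (?h x f)))))"
      by (simp only: hh assms(2) fg_add_commute[of \<beta> "fg_add \<beta> z y" y])
    finally show ?thesis using True Suc by (simp only: F_list_Suc)
  qed
qed simp

section \<open>Factorization along the rows of the diagram\<close>


lemma foldr_rev_commute:
  assumes "\<And>i j f. i \<in> set is \<Longrightarrow> j \<in> set is \<Longrightarrow> F i (F j f) = F j (F i f)"
  shows "foldr F (rev is) f = foldr F is f"
  using assms
proof (induction "is" arbitrary: f)
  case (Cons i "is")
  have comm: "foldr F js (F i g) = F i (foldr F js g)" if "set js \<subseteq> set (i # is)" for js g
    using that by (induction js arbitrary: g) (auto simp: Cons.prems)
  have "foldr F is (F i f) = F i (foldr F is f)" by (rule comm) auto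
  then show ?case using Cons by simp
qed simp

lemma hops_concat: "hops \<beta> (concat (map L is)) f = foldr (\<lambda>i. hops \<beta> (L i)) is f"
  by (induction "is") auto

lemma F_list_commute_field:
  fixes \<beta> :: "'r::field"
  assumes "n \<ge> 2" "1 + \<beta> * y \<noteq> 0"
  shows "hops \<beta> (F_list n x) (hops \<beta> (F_list n y) f) = hops \<beta> (F_list n y) (hops \<beta> (F_list n x) f)"
proof (rule F_list_commute[OF assms(1)])
  define z where "z = (x - y) / (1 + \<beta> * y)"
  then have "z * (1 + \<beta> * y) = x - y" using assms(2) by simp
  then have "x = z * (1 + \<beta> * y) + y" by simp
  also have "\<dots> = fg_add \<beta> z y" by (simp add: fg_add_def algebra_simps)
  finally show "x = fg_add \<beta> z y" .
qed

text \<open>Generators of row \<open>j\<close> of the trapezoid. Consecutive rows differ only in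
  their first node, one on each branch; row 1, the last block of \<open>Delta_D\<close>, uses
  \<open>S 1\<close>.\<close>

definition row_gens :: "nat \<Rightarrow> nat \<Rightarrow> gen list" where
  "row_gens n j = (if odd j then S 1 else Hat) # map S [2..<n]"

lemma chain_map_S: "0 < i \<Longrightarrow> chain (map S [i..<n])"
proof (induction "n - i" arbitrary: i)
  case (Suc k)
  then have *: "map S [i..<n] = S i # map S [Suc i..<n]" by (simp add: upt_conv_Cons)
  have c: "chain (map S [Suc i..<n])" using Suc by (intro Suc.hyps(1)) auto
  show ?case
  proof (cases "Suc i < n")
    case True
    then have "map S [Suc i..<n] = S (Suc i) # map S [Suc (Suc i)..<n]" by (simp add: upt_conv_Cons)
    then show ?thesis using c Suc.prems unfolding * by (auto simp: adj_simps far_simps)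
  next
    case False
    then show ?thesis using Suc.prems unfolding * by (simp add: valid_def)
  qed
qed simp

lemma chain_row_gens: "chain (row_gens n j)"
proof (cases "2 < n")
  case True
  then have "map S [2..<n] = S 2 # map S [3..<n]" by (simp add: upt_conv_Cons)
  then show ?thesis
    using chain_map_S[of 2 n] by (auto simp: row_gens_def adj_simps far_simps)
next
  case False
  then show ?thesis by (simp add: row_gens_def valid_def)
qed

lemma row_gens_odd: "n \<ge> 2 \<Longrightarrow> odd j \<Longrightarrow> row_gens n j = map S [1..<n]"
  using upt_conv_Cons[of 1 n] by (simp add: row_gens_def numeral_2_eq_2)

lemma hops_F_list:
  assumes "n \<ge> 2"
  shows "hops \<beta> (F_list n x) f = hops \<beta> (downs (row_gens n (Suc j)) x) (hops \<beta> (ups (row_gens n j) x) f)"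
proof -
  have 1: "F_list n x = downs (map S [2..<n]) x @ [(S 1, x), (Hat, x)] @ ups (map S [2..<n]) x"
    using assms upt_conv_Cons[of 1 n]
    by (simp add: F_list_def downs_def ups_def rev_map numeral_2_eq_2)
  have far: "far (S 1) Hat" by (simp add: far_simps)
  show ?thesis
    using hop_far[OF far, of \<beta> x x] by (cases "odd j") (simp_all add: 1 row_gens_def)
qed

text \<open>The increasing half of F consumes the branch node of G and leaves G on S 2, ..., S (n -
  1), a chain common to both branches. Preceded by the decreasing half of F, which ends in the other
  branch node, this is a full G again, with \<open>x\<close> prepended to its parameters.\<close>

lemma F_list_G_list:
  assumes "n \<ge> 2"
  shows "hops \<beta> (F_list n x) (hops \<beta> (G_list (row_gens n j) y) f) =
    hops \<beta> (G_list (row_gens n (Suc j)) (case_nat x y)) (hops \<beta> (row_list \<beta> (row_gens n j) x y) f)"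
proof -
  have tl: "tl (row_gens n j) = map S [2..<n]" "\<And>z. G_list (row_gens n (Suc j)) z =
      downs (row_gens n (Suc j)) (z 0) @ G_list (map S [2..<n]) (z \<circ> Suc)"
    by (simp_all add: row_gens_def)
  have c: "case_nat x y \<circ> Suc = y" by (rule ext) simp
  show ?thesis
    by (simp only: hops_F_list[OF assms, of _ _ _ j] ups_G_list[OF chain_row_gens] tl c
        hops_append nat.case)
qed

text \<open>The factors are absorbed from the right, so \<open>x 1\<close> comes first, and after
  \<open>j\<close> rows the parameters of G are \<open>p\<close> from index n + 1 - j on. Row
  \<open>i\<close> is split off while they begin at n + 2 - i, one place after the entry
  \<open>p (n + 1 - i)\<close> = \<open>x i\<close> that is about to be prepended: column n + 1 - i
  is missing in row \<open>i\<close>.\<close>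

lemma F_lists_G_list:
  assumes "n \<ge> 2" "j \<le> n" "\<And>i. 1 \<le> i \<Longrightarrow> i \<le> n \<Longrightarrow> p i = x (n + 1 - i)"
  shows "hops \<beta> (concat (map (\<lambda>i. F_list n (x i)) (rev [1..<j + 1])))
      (hops \<beta> (G_list (row_gens n 1) (\<lambda>k. p (n + 1 + k))) f) =
    hops \<beta> (G_list (row_gens n (Suc j)) (\<lambda>k. p (n + 1 - j + k)))
      (hops \<beta> (concat (map (\<lambda>i. row_list \<beta> (row_gens n i) (x i) (\<lambda>k. p (n + 2 - i + k)))
        (rev [1..<j + 1]))) f)"
  using assms(2)
proof (induction j)
  case (Suc j)
  have eq: "case_nat (x (Suc j)) (\<lambda>k. p (n + 1 - j + k)) = (\<lambda>k. p (n + 1 - Suc j + k))"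
    using Suc.prems by (auto simp: fun_eq_iff assms(3) Suc_diff_le split: nat.split)
  have sh: "(\<lambda>k. p (n + 2 - Suc j + k)) = (\<lambda>k. p (n + 1 - j + k))" by simp
  have l: "rev [1..<Suc j + 1] = Suc j # rev [1..<j + 1]" by simp
  show ?case
    unfolding l list.map concat.simps hops_append
    using Suc.IH Suc.prems F_list_G_list[OF assms(1), of \<beta> "x (Suc j)" "Suc j" "\<lambda>k. p (n + 1 - j + k)"]
    unfolding eq sh by simp
qed simp

section \<open>Matching the rows with \<open>Delta_D\<close> and its coordinates\<close>

lemma row_list_eq_zip:
  assumes "length cs = length gs" "\<And>k. k < length gs \<Longrightarrow> cs ! k = fg_add \<beta> (y k) b"
  shows "row_list \<beta> gs b y = zip gs cs"
  using assms
proof (induction gs arbitrary: cs y)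
  case (Cons g gs)
  then obtain c cs' where cs: "cs = c # cs'" by (cases cs) auto
  have "c = fg_add \<beta> (y 0) b" using Cons.prems(2)[of 0] by (simp add: cs)
  moreover have "row_list \<beta> gs b (y \<circ> Suc) = zip gs cs'"
    using Cons.prems(1) Cons.prems(2)[of "Suc _"] by (intro Cons.IH) (auto simp: cs)
  ultimately show ?case by (simp add: cs)
qed simp

lemma triangle_list_rows:
  assumes "i \<le> n"
  shows "triangle_list \<beta> (map S [i..<n]) (\<lambda>k. b (i + k)) y =
    concat (map (\<lambda>r. row_list \<beta> (map S [n - r..<n]) (b (n - r)) y) [1..<n - i + 1])"
  using assms
proof (induction "n - i" arbitrary: i)
  case (Suc k)
  then have *: "map S [i..<n] = S i # map S [Suc i..<n]" by (simp add: upt_conv_Cons)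
  have l: "[1..<n - i + 1] = [1..<n - Suc i + 1] @ [n - i]"
    using Suc.hyps(2) by (simp add: Suc_diff_Suc)
  have c: "(\<lambda>k. b (i + k)) \<circ> Suc = (\<lambda>k. b (Suc i + k))" by (rule ext) simp
  have d: "n - (n - i) = i" using Suc.prems by simp
  have IH: "triangle_list \<beta> (map S [Suc i..<n]) (\<lambda>k. b (Suc i + k)) y =
    concat (map (\<lambda>r. row_list \<beta> (map S [n - r..<n]) (b (n - r)) y) [1..<n - Suc i + 1])"
    by (rule Suc.hyps(1)) (use Suc.hyps(2) in auto)
  show ?case
    unfolding l map_append concat_append list.map concat.simps d append_Nil2 IH[symmetric]
    by (simp only: * triangle_list.simps c add_0_right)
qed simp

lemma zip_concat_map:
  "(\<And>x. x \<in> set xs \<Longrightarrow> length (f x) = length (g x)) \<Longrightarrow>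
   zip (concat (map f xs)) (concat (map g xs)) = concat (map (\<lambda>x. zip (f x) (g x)) xs)"
  by (induction xs) (auto simp: zip_append)

lemma length_concat_map_cong:
  "(\<And>x. x \<in> set xs \<Longrightarrow> length (f x) = length (g x)) \<Longrightarrow>
   length (concat (map f xs)) = length (concat (map g xs))"
  by (induction xs) auto

lemma concat_replicate_two:
  "concat (replicate m (xs @ ys)) =
   concat (map (\<lambda>j. if odd j then ys else xs) (rev [1..<2 * m + 1]))"
  by (induction m) auto

lemma rev_upt_1: "rev [1..<n] = map (\<lambda>r. n - r) [1..<n]"
  by (rule nth_equalityI) (auto simp: rev_nth)

definition coord_wt ::
  "'r::comm_ring_1 \<Rightarrow> nat \<Rightarrow> (nat \<Rightarrow> 'r) \<Rightarrow> (nat \<Rightarrow> 'r) \<Rightarrow> (nat \<Rightarrow> 'r) \<Rightarrow> nat \<times> nat \<Rightarrow> 'r" where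
  "coord_wt \<beta> n a b x = (\<lambda>(i, j).
     fg_add \<beta> (if i \<le> n then x (n + 1 - i) else a (i - n)) (if j \<le> n then x j else b (j - n)))"

lemma Delta_D_rows:
  assumes "m \<ge> 1" "n = 2 * m"
  shows "Delta_D n = concat (map (\<lambda>r. map S [n - r..<n]) [1..<n]) @
    concat (map (row_gens n) (rev [1..<n + 1]))"
proof -
  have "(\<lambda>j. if odd j then map S [1..<n] else [Hat] @ map S [2..<n]) = row_gens n"
    using row_gens_odd[of n] assms by (auto simp: row_gens_def fun_eq_iff)
  moreover have "n div 2 = m" using assms by simp
  ultimately show ?thesis
    unfolding Delta_D_def Delta_A_def rev_upt_1[of n] concat_replicate_two map_map o_def
    by (simp only: assms(2) mult.commute)
qed

text \<open>Counting \<open>k\<close> from 0, entry \<open>k\<close> of a triangle row stands in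
  column k + 1 and contributes \<open>x (n - k)\<close>; entry \<open>k\<close> of row
  \<open>j\<close> of the trapezoid stands in column n + 2 - j + k.\<close>

lemma weighted_Delta_D:
  assumes "m \<ge> 1" "n = 2 * m"
  shows "length (coords_D n) = length (Delta_D n)"
    and "zip (Delta_D n) (map (coord_wt \<beta> n a b x) (coords_D n)) =
      triangle_list \<beta> (map S [1..<n]) (\<lambda>k. b (1 + k)) (\<lambda>k. x (n - k)) @
      concat (map (\<lambda>j. row_list \<beta> (row_gens n j) (x j)
          (\<lambda>k. if n + 2 - j + k \<le> n then x (n + 1 - (n + 2 - j + k)) else a (n + 2 - j + k - n)))
        (rev [1..<n + 1]))" (is "_ = ?R")
proof -
  let ?A = "\<lambda>r. map S [n - r..<n]" and ?B = "row_gens n"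
  let ?ca = "\<lambda>r. map (\<lambda>i. (i, 2 * n - r)) [1..<r + 1]"
    and ?cb = "\<lambda>j. map (\<lambda>i. (i, j)) [n + 2 - j..<2 * n - j + 1]"
  let ?w = "coord_wt \<beta> n a b x"
  have la: "length (?A r) = length (?ca r)" if "r \<in> set [1..<n]" for r using that by auto
  have lb: "length (?B j) = length (?cb j)" if "j \<in> set (rev [1..<n + 1])" for j
    using that assms by (auto simp: row_gens_def)
  have lA: "length (concat (map ?A [1..<n])) = length (concat (map ?ca [1..<n]))"
    by (rule length_concat_map_cong[OF la])
  have lB: "length (concat (map ?B (rev [1..<n + 1]))) = length (concat (map ?cb (rev [1..<n + 1])))"
    by (rule length_concat_map_cong[OF lb])
  note D = Delta_D_rows[OF assms]
  show "length (coords_D n) = length (Delta_D n)"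
    unfolding D coords_D_def length_append lA lB ..
  have l: "length (concat (map ?A [1..<n])) = length (concat (map (map ?w \<circ> ?ca) [1..<n]))"
    by (rule length_concat_map_cong) (use la in auto)
  have "zip (Delta_D n) (map ?w (coords_D n)) =
    zip (concat (map ?A [1..<n])) (concat (map (map ?w \<circ> ?ca) [1..<n])) @
    zip (concat (map ?B (rev [1..<n + 1]))) (concat (map (map ?w \<circ> ?cb) (rev [1..<n + 1])))"
    unfolding D coords_D_def map_append map_concat map_map
    by (rule zip_append) (use l in simp)
  also have "zip (concat (map ?A [1..<n])) (concat (map (map ?w \<circ> ?ca) [1..<n])) =
      concat (map (\<lambda>r. zip (?A r) ((map ?w \<circ> ?ca) r)) [1..<n])"
    by (rule zip_concat_map) (use la in auto)
  also have "\<dots> = concat (map (\<lambda>r. row_list \<beta> (?A r) (b (n - r)) (\<lambda>k. x (n - k))) [1..<n])"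
  proof (rule arg_cong[where f = concat], rule map_cong[OF refl])
    fix r assume r: "r \<in> set [1..<n]"
    show "zip (?A r) ((map ?w \<circ> ?ca) r) = row_list \<beta> (?A r) (b (n - r)) (\<lambda>k. x (n - k))"
    proof (rule row_list_eq_zip[symmetric])
      have d: "2 * n - r - n = n - r" by simp
      show "(map ?w \<circ> ?ca) r ! k = fg_add \<beta> (x (n - k)) (b (n - r))" if "k < length (?A r)" for k
      proof -
        have "k < r + 1 - 1" using that r by simp
        then have e: "(map ?w \<circ> ?ca) r ! k = ?w (1 + k, 2 * n - r)"
          by (simp only: comp_apply map_map nth_map_upt)
        have f: "\<not> 2 * n - r \<le> n" "1 + k \<le> n" "n + 1 - (1 + k) = n - k" using that r by auto
        show ?thesis unfolding e
          by (simp only: coord_wt_def case_prod_conv d f if_True if_False)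
      qed
    qed (use la[OF r] in simp)
  qed
  also have "\<dots> = triangle_list \<beta> (map S [1..<n]) (\<lambda>k. b (1 + k)) (\<lambda>k. x (n - k))"
    using triangle_list_rows[of 1 n \<beta> b] assms by simp
  also have "zip (concat (map ?B (rev [1..<n + 1]))) (concat (map (map ?w \<circ> ?cb) (rev [1..<n + 1]))) =
      concat (map (\<lambda>j. zip (?B j) ((map ?w \<circ> ?cb) j)) (rev [1..<n + 1]))"
    by (rule zip_concat_map) (use lb in auto)
  also have "\<dots> = concat (map (\<lambda>j. row_list \<beta> (?B j) (x j)
      (\<lambda>k. if n + 2 - j + k \<le> n then x (n + 1 - (n + 2 - j + k)) else a (n + 2 - j + k - n)))
      (rev [1..<n + 1]))"
  proof (rule arg_cong[where f = concat], rule map_cong[OF refl])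
    fix j assume j: "j \<in> set (rev [1..<n + 1])"
    show "zip (?B j) ((map ?w \<circ> ?cb) j) = row_list \<beta> (?B j) (x j)
      (\<lambda>k. if n + 2 - j + k \<le> n then x (n + 1 - (n + 2 - j + k)) else a (n + 2 - j + k - n))"
    proof (rule row_list_eq_zip[symmetric])
      fix k assume "k < length (?B j)"
      then have "k < 2 * n - j + 1 - (n + 2 - j)" using lb[OF j] by (simp del: upt_Suc)
      then have "(map ?w \<circ> ?cb) j ! k = ?w (n + 2 - j + k, j)"
        by (simp only: comp_apply map_map nth_map_upt)
      moreover have "j \<le> n" using j by auto
      ultimately show "(map ?w \<circ> ?cb) j ! k = fg_add \<beta>
          (if n + 2 - j + k \<le> n then x (n + 1 - (n + 2 - j + k)) else a (n + 2 - j + k - n)) (x j)"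
        by (simp only: coord_wt_def case_prod_conv if_True)
    qed (use lb[OF j] in simp)
  qed
  finally show "zip (Delta_D n) (map ?w (coords_D n)) = ?R" .
qed

section \<open>Expansion into reduced subwords\<close>


lemma nths_restrict: "nths xs A = nths xs (A \<inter> {..<length xs})"
  unfolding nths_def by (rule arg_cong[where f = "map fst"], rule filter_cong) (auto simp: in_set_zip)

text \<open>The product is left open: the induction on the word passes through all group elements,
  and the function \<open>f\<close> in \<open>hops_subwords\<close> selects among them.\<close>

definition red_positions :: "nat \<Rightarrow> gen list \<Rightarrow> nat set set" where
  "red_positions n ds =
     {J. J \<subseteq> {..<length ds} \<and> reduced_word n (word_prod (nths ds J)) (nths ds J)}"

text \<open>The Demazure condition of \<open>B_set\<close> expressed by descents, so that the
  expansion stays free of the algebra; \<open>B_set_stalls\<close> identifies the two.\<close>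

definition stalls :: "gen list \<Rightarrow> nat set \<Rightarrow> nat set" where
  "stalls ds J =
     {j. j < length ds \<and> j \<notin> J \<and> \<not> ascent (ds ! j) (word_prod (nths ds (J \<inter> {..<j})))}"

lemma finite_red_positions [simp]: "finite (red_positions n ds)"
  by (rule finite_subset[of _ "Pow {..<length ds}"]) (auto simp: red_positions_def)

lemma finite_stalls [simp]: "finite (stalls ds J)"
  by (simp add: stalls_def)

lemma nths_snoc:
  assumes "J \<subseteq> {..<length ds}"
  shows "nths (ds @ [s]) J = nths ds J" "nths (ds @ [s]) (insert (length ds) J) = nths ds J @ [s]"
    "nths ds (insert (length ds) J) = nths ds J"
proof -
  have J: "length ds \<notin> J" using assms by auto
  show *: "nths ds (insert (length ds) J) = nths ds J"
    using nths_restrict[of ds "insert (length ds) J"] nths_restrict[of ds J] by simp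
  show "nths (ds @ [s]) J = nths ds J" "nths (ds @ [s]) (insert (length ds) J) = nths ds J @ [s]"
    using J by (simp_all add: nths_append *)
qed

lemma red_positions_snoc:
  assumes "s \<in> gens_D n"
  shows "red_positions n (ds @ [s]) = red_positions n ds \<union>
    insert (length ds) ` {J \<in> red_positions n ds. ascent s (word_prod (nths ds J))}"
    (is "_ = ?R \<union> _")
proof -
  let ?N = "length ds"
  have in1: "J \<in> red_positions n (ds @ [s]) \<longleftrightarrow> J \<in> red_positions n ds" if "J \<subseteq> {..<?N}" for J
    using that nths_snoc(1)[OF that, of s] by (auto simp: red_positions_def)
  have in2: "insert ?N J \<in> red_positions n (ds @ [s]) \<longleftrightarrow>
      J \<in> red_positions n ds \<and> ascent s (word_prod (nths ds J))" if J: "J \<subseteq> {..<?N}" for J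
  proof -
    let ?w = "word_prod (nths ds J)"
    have v: "valid s" using assms by (rule gens_D_valid)
    have "reduced_word n (?w \<circ> simple_refl s) (nths ds J @ [s]) \<longleftrightarrow>
        reduced_word n ?w (nths ds J) \<and> ascent s ?w" (is "?A \<longleftrightarrow> ?B")
    proof
      assume ?A
      note r = reduced_word_snocD[OF this]
      have w: "reduced_word n ?w (nths ds J)" using r(2) by (simp only: comp_simple_refl_twice[OF v])
      with r(3) show ?B
        using ascent_comp_self[OF v signed_perm_W_D[OF reduced_word_in_W_D[OF w]]] by blast
    qed (use assms reduced_word_snoc in blast)
    moreover have "insert ?N J \<subseteq> {..<length (ds @ [s])}" using J by auto
    ultimately show ?thesis
      using J by (simp add: red_positions_def nths_snoc(2)[OF J] del: length_append)
  qed
  have sub: "J \<subseteq> {..<?N}" if "J \<in> red_positions n ds" for J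
    using that by (simp add: red_positions_def)
  show ?thesis
  proof (intro Set.set_eqI iffI)
    fix K assume K: "K \<in> red_positions n (ds @ [s])"
    then have K': "K \<subseteq> {..<Suc ?N}" by (simp add: red_positions_def)
    show "K \<in> ?R \<union> insert ?N ` {J \<in> red_positions n ds. ascent s (word_prod (nths ds J))}"
    proof (cases "?N \<in> K")
      case True
      then have "K = insert ?N (K - {?N})" "K - {?N} \<subseteq> {..<?N}" using K' by (auto simp: less_Suc_eq)
      then obtain J where "K = insert ?N J" "J \<subseteq> {..<?N}" by blast
      then show ?thesis using in2[of J] K by auto
    next
      case False
      then have "K \<subseteq> {..<?N}" using K' by (auto simp: less_Suc_eq)
      then show ?thesis using in1 K by auto
    qed
  next
    fix K assume "K \<in> ?R \<union> insert ?N ` {J \<in> red_positions n ds. ascent s (word_prod (nths ds J))}"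
    then show "K \<in> red_positions n (ds @ [s])" using in1 in2 sub by auto
  qed
qed

lemma stalls_snoc:
  assumes "J \<subseteq> {..<length ds}"
  shows "stalls (ds @ [s]) (insert (length ds) J) = stalls ds J"
    "stalls (ds @ [s]) J =
      (if ascent s (word_prod (nths ds J)) then stalls ds J else insert (length ds) (stalls ds J))"
proof -
  let ?N = "length ds"
  have J: "J \<inter> {..<?N} = J" "?N \<notin> J" using assms by auto
  have pre: "nths (ds @ [s]) (J \<inter> {..<j}) = nths ds (J \<inter> {..<j})" for j
    by (rule nths_snoc(1)) (use assms in auto)
  have ins: "insert ?N J \<inter> {..<j} = J \<inter> {..<j}" if "j < ?N" for j using that by auto
  show "stalls (ds @ [s]) (insert ?N J) = stalls ds J"
    by (rule Set.set_eqI)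
      (auto simp: stalls_def less_Suc_eq nth_append ins pre simp del: Int_insert_left)
  show "stalls (ds @ [s]) J =
      (if ascent s (word_prod (nths ds J)) then stalls ds J else insert ?N (stalls ds J))"
    by (rule Set.set_eqI) (auto simp: stalls_def less_Suc_eq nth_append pre J)
qed

text \<open>Induction on the last letter, which is absorbed into \<open>f\<close>. At an ascent its
  factor yields f(w) + t f(w s), the choice between skipping and taking the position. At a descent
  it yields (1 + \<beta> t) f(w): the position cannot be taken and becomes a stall.\<close>

lemma hops_subwords:
  assumes "set ds \<subseteq> gens_D n"
  shows "hops \<beta> (map (\<lambda>k. (ds ! k, t k)) [0..<length ds]) f id =
    (\<Sum>J \<in> red_positions n ds. (\<Prod>k\<in>J. t k) * (\<Prod>k\<in>stalls ds J. 1 + \<beta> * t k) *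
       f (word_prod (nths ds J)))"
  using assms
proof (induction ds arbitrary: f rule: rev_induct)
  case Nil
  have "red_positions n [] = {{}}" "stalls [] {} = {}"
    using len_D_le[of "[]" n] by (auto simp: red_positions_def stalls_def reduced_word_def)
  then show ?case by simp
next
  case (snoc s ds)
  let ?N = "length ds" and ?w = "\<lambda>J. word_prod (nths ds J)"
  define G where "G J = (\<Prod>k\<in>J. t k) * (\<Prod>k\<in>stalls ds J. 1 + \<beta> * t k)" for J
  define G' where "G' J = (\<Prod>k\<in>J. t k) * (\<Prod>k\<in>stalls (ds @ [s]) J. 1 + \<beta> * t k) *
       f (word_prod (nths (ds @ [s]) J))" for J
  let ?R = "red_positions n ds" and ?U = "{J \<in> red_positions n ds. ascent s (?w J)}"
  have s: "s \<in> gens_D n" using snoc.prems by simp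
  have sub: "J \<subseteq> {..<?N}" if "J \<in> ?R" for J
    using that by (simp add: red_positions_def)
  have notin: "?N \<notin> J" if "J \<in> ?R" for J using sub[OF that] by auto
  have l: "map (\<lambda>k. ((ds @ [s]) ! k, t k)) [0..<length (ds @ [s])] =
      map (\<lambda>k. (ds ! k, t k)) [0..<?N] @ [(s, t ?N)]"
    by (simp add: nth_append)
  have *: "G' J + (if ascent s (?w J) then G' (insert ?N J) else 0) = G J * hop \<beta> s (t ?N) f (?w J)"
    if J: "J \<in> ?R" for J
  proof -
    have fin: "finite J" using sub[OF J] finite_subset by blast
    have N: "?N \<notin> stalls ds J" by (simp add: stalls_def)
    have sp: "signed_perm (?w J)"
      using J signed_perm_W_D reduced_word_in_W_D unfolding red_positions_def by blast
    show ?thesis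
      using sp N fin notin[OF J]
      by (simp add: G'_def G_def stalls_snoc[OF sub[OF J]] nths_snoc(1,2)[OF sub[OF J]] hop_def uop_def
          algebra_simps)
  qed
  have "(\<Sum>J \<in> red_positions n (ds @ [s]). G' J) = (\<Sum>J\<in>?R. G' J) + (\<Sum>J\<in>insert ?N ` ?U. G' J)"
    unfolding red_positions_snoc[OF s] using notin by (intro sum.union_disjoint) auto
  also have "(\<Sum>J\<in>insert ?N ` ?U. G' J) = (\<Sum>J\<in>?U. G' (insert ?N J))"
    by (rule sum.reindex_cong[OF _ refl refl]) (use notin in \<open>auto simp: inj_on_def dest: insert_ident\<close>)
  also have "\<dots> = (\<Sum>J\<in>?R. if ascent s (?w J) then G' (insert ?N J) else 0)"
    by (simp add: sum.If_cases Int_def)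
  also have "(\<Sum>J\<in>?R. G' J) + \<dots> = (\<Sum>J\<in>?R. G J * hop \<beta> s (t ?N) f (?w J))"
    unfolding sum.distrib[symmetric] by (rule sum.cong[OF refl *])
  also have "\<dots> = hops \<beta> (map (\<lambda>k. (ds ! k, t k)) [0..<?N]) (hop \<beta> s (t ?N) f) id"
    unfolding G_def by (rule snoc.IH[symmetric]) (use snoc.prems in simp)
  finally show ?case unfolding l G'_def hops_append hops_Cons hops_Nil by (rule sym)
qed

section \<open>Coefficients at a parabolic subgroup\<close>

lemma W_D_fixes:
  assumes "w \<in> W_D n" "n \<ge> 2" "k > n"
  shows "w (int k) = int k"
  using permutes_W_D[OF assms(1,2)] assms(3) by (auto simp: permutes_def)

lemma W_D_less:
  assumes "w \<in> W_D n" "n \<ge> 2"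
  shows "w (int n) < int (Suc n)"
  using permutes_in_image[OF permutes_W_D[OF assms], of "int n"] by simp

text \<open>Steps that increase the length never increase \<open>w (n + 1)\<close>, so a path that has left the
  parabolic subgroup does not return to it.\<close>

lemma hops_parabolic:
  fixes f :: "(int \<Rightarrow> int) \<Rightarrow> 'r::comm_ring_1"
  assumes n: "n \<ge> 2" and l: "fst ` set l \<subseteq> gens_D (Suc n)"
    and f: "\<And>v. v (int (Suc n)) < int (Suc n) \<Longrightarrow> f v = 0"
    and w: "w \<in> W_D n"
  shows "hops \<beta> l f w = hops \<beta> (filter (\<lambda>p. fst p \<noteq> S n) l) f w"
proof -
  let ?N = "int (Suc n)"
  have gens: "s \<in> gens_D (Suc n) \<longleftrightarrow> s = S n \<or> s \<in> gens_D n" for s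
    using n by (auto simp: gens_D_def less_Suc_eq)
  have fixed: "simple_refl s ?N = ?N" if "s \<in> gens_D n" for s
    using that n by (auto simp: gens_D_def refl_simps)
  have top: "simple_refl (S n) ?N = int n" using n by (simp add: refl_simps)
  have asc: "ascent (S n) v \<longleftrightarrow> v (int n) < v ?N" for v
    by (simp add: ascent_def add.commute)
  have vanish: "hops \<beta> l f v = 0" if "fst ` set l \<subseteq> gens_D (Suc n)" "v ?N < ?N" for l v
    using that
  proof (induction l arbitrary: v)
    case (Cons p l)
    obtain s t where p: "p = (s, t)" by (cases p)
    have 1: "hops \<beta> l f v' = 0" if "v' ?N < ?N" for v' using Cons that by auto
    have s: "s = S n \<or> s \<in> gens_D n" using Cons.prems(1) gens p by auto
    have "(v \<circ> simple_refl s) ?N < ?N" if "ascent s v"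
      using s
    proof
      assume "s = S n"
      then show ?thesis using that asc[of v] top Cons.prems(2) by simp
    next
      assume "s \<in> gens_D n"
      then show ?thesis using fixed Cons.prems(2) by simp
    qed
    then show ?case using 1 Cons.prems(2) by (simp add: p hop_def uop_def)
  qed (use f in simp)
  show ?thesis
    using l w
  proof (induction l arbitrary: w)
    case (Cons p l)
    obtain s t where p: "p = (s, t)" by (cases p)
    have IH: "hops \<beta> l f v = hops \<beta> (filter (\<lambda>p. fst p \<noteq> S n) l) f v" if "v \<in> W_D n" for v
      using Cons that by auto
    have sl: "s = S n \<or> s \<in> gens_D n" "fst ` set l \<subseteq> gens_D (Suc n)"
      using Cons.prems(1) gens p by auto
    show ?case
    proof (cases "s = S n")
      case True
      have "w ?N = ?N" using W_D_fixes[OF Cons.prems(2) n, of "Suc n"] by simp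
      moreover have "w (int n) < ?N" using W_D_less[OF Cons.prems(2) n] .
      ultimately have "ascent s w" "(w \<circ> simple_refl s) ?N < ?N"
        using True asc[of w] top by simp_all
      then have "uop \<beta> s (hops \<beta> l f) w = 0" using vanish[OF sl(2)] by (simp add: uop_def)
      then show ?thesis using IH[OF Cons.prems(2)] True by (simp add: p hop_def)
    next
      case False
      then have "s \<in> gens_D n" using sl by simp
      then show ?thesis
        using False IH[OF Cons.prems(2)] IH[OF W_D_comp[OF Cons.prems(2)]]
        by (simp add: p hop_def uop_def)
    qed
  qed simp
qed

section \<open>Action of the idCoxeter algebra\<close>


definition wop :: "'r::comm_ring_1 \<Rightarrow> gen list \<Rightarrow> ((int \<Rightarrow> int) \<Rightarrow> 'r) \<Rightarrow> (int \<Rightarrow> int) \<Rightarrow> 'r" where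
  "wop \<beta> ds f = foldr (uop \<beta>) ds f"

lemma wop_Nil [simp]: "wop \<beta> [] f = f"
  and wop_Cons [simp]: "wop \<beta> (d # ds) f = uop \<beta> d (wop \<beta> ds f)"
  and wop_append: "wop \<beta> (ds @ es) f = wop \<beta> ds (wop \<beta> es f)"
  by (simp_all add: wop_def)

lemma wop_plus: "wop \<beta> ds (\<lambda>w. f w + g w) = (\<lambda>w. wop \<beta> ds f w + wop \<beta> ds g w)"
  by (induction ds) (simp_all add: uop_plus)

lemma wop_mult: "wop \<beta> ds (\<lambda>w. c * f w) = (\<lambda>w. c * wop \<beta> ds f w)"
  by (induction ds) (simp_all add: uop_mult)

lemma wop_0: "wop \<beta> ds (\<lambda>w. 0) = (\<lambda>w. 0)"
  using wop_mult[of \<beta> ds 0] by simp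

definition act ::
  "'r::comm_ring_1 \<Rightarrow> (gen free_word \<Rightarrow>\<^sub>0 'r) \<Rightarrow> ((int \<Rightarrow> int) \<Rightarrow> 'r) \<Rightarrow> (int \<Rightarrow> int) \<Rightarrow> 'r" where
  "act \<beta> p f w = (\<Sum>v\<in>Poly_Mapping.keys p. Poly_Mapping.lookup p v * wop \<beta> (letters v) f w)"

lemma act_superset:
  assumes "finite A" "Poly_Mapping.keys p \<subseteq> A"
  shows "act \<beta> p f w = (\<Sum>v\<in>A. Poly_Mapping.lookup p v * wop \<beta> (letters v) f w)"
  unfolding act_def using assms by (intro sum.mono_neutral_left) (auto simp: in_keys_iff)

lemma act_0 [simp]: "act \<beta> 0 f w = 0"
  by (simp add: act_def)

lemma act_plus: "act \<beta> (p + q) f w = act \<beta> p f w + act \<beta> q f w"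
proof -
  let ?A = "Poly_Mapping.keys p \<union> Poly_Mapping.keys q"
  have *: "finite ?A" "Poly_Mapping.keys (p + q) \<subseteq> ?A" "Poly_Mapping.keys p \<subseteq> ?A"
    "Poly_Mapping.keys q \<subseteq> ?A"
    using keys_add[of p q] by auto
  show ?thesis
    unfolding act_superset[OF *(1,2)] act_superset[OF *(1,3)] act_superset[OF *(1,4)]
    by (simp add: lookup_add distrib_right sum.distrib)
qed

lemma act_uminus: "act \<beta> (- p) f w = - act \<beta> p f w"
  by (simp add: act_def sum_negf)

lemma act_minus: "act \<beta> (p - q) f w = act \<beta> p f w - act \<beta> q f w"
  using act_plus[of \<beta> p "- q"] by (simp add: act_uminus)

lemma act_sum: "act \<beta> (\<Sum>i\<in>I. p i) f w = (\<Sum>i\<in>I. act \<beta> (p i) f w)"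
  by (induction I rule: infinite_finite_induct) (simp_all add: act_plus)

lemma act_single: "act \<beta> (Poly_Mapping.single v c) f w = c * wop \<beta> (letters v) f w"
  by (cases "c = 0") (simp_all add: act_def)

lemma update_eq_plus_single:
  "k \<notin> Poly_Mapping.keys p \<Longrightarrow> Poly_Mapping.update k c p = Poly_Mapping.single k c + p"
  by (rule poly_mapping_eqI) (auto simp: lookup_update lookup_add lookup_single in_keys_iff when_def)

lemma poly_mapping_single_induct [case_names zero single]:
  assumes "P 0"
    and "\<And>k c p. k \<notin> Poly_Mapping.keys p \<Longrightarrow> c \<noteq> 0 \<Longrightarrow> P p \<Longrightarrow> P (Poly_Mapping.single k c + p)"
  shows "P p"
  using assms by (induction p rule: update_induct) (auto simp: update_eq_plus_single)

lemma letters_plus [simp]: "letters (v + w) = letters v @ letters w"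
  by (simp add: plus_free_word_def)

lemma letters_zero [simp]: "letters 0 = []"
  by (simp add: zero_free_word_def)

lemma act_single_mult: "act \<beta> (Poly_Mapping.single v c * q) f w = c * wop \<beta> (letters v) (act \<beta> q f) w"
proof (induction q arbitrary: w rule: poly_mapping_single_induct)
  case zero
  have "act \<beta> 0 f = (\<lambda>w. 0)" by (rule ext) simp
  then show ?case by (simp add: wop_0)
next
  case (single k d p)
  have "act \<beta> (Poly_Mapping.single k d + p) f = (\<lambda>w. d * wop \<beta> (letters k) f w + act \<beta> p f w)"
    by (rule ext) (simp add: act_plus act_single)
  then show ?case
    using single by (simp add: distrib_left mult_single act_plus act_single wop_plus wop_mult wop_append mult.assoc)
qed

lemma act_mult: "act \<beta> (p * q) f = act \<beta> p (act \<beta> q f)"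
proof
  fix w
  show "act \<beta> (p * q) f w = act \<beta> p (act \<beta> q f) w"
    by (induction p rule: poly_mapping_single_induct)
      (simp_all add: distrib_right act_plus act_single_mult act_single)
qed

lemma act_const [simp]: "act \<beta> (const c) f w = c * f w"
  by (simp add: const_def act_single)

lemma act_monomial [simp]: "act \<beta> (monomial ds) f w = wop \<beta> ds f w"
  by (simp add: monomial_def act_single)

lemma act_one [simp]: "act \<beta> 1 f = f"
  using act_const[of \<beta> 1] by (simp add: const_def fun_eq_iff)

lemma monomial_mult: "monomial ds * monomial es = monomial (ds @ es)"
  by (simp add: monomial_def mult_single plus_free_word_def)

lemma const_commute: "p * const c = const c * p"
  by (induction p rule: poly_mapping_single_induct)
    (simp_all add: algebra_simps const_def mult_single)

lemma const_mult: "const c * const d = const (c * d)"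
  by (simp add: const_def mult_single)

lemma const_plus: "const (c + d) = const c + const d"
  by (simp add: const_def single_add)

section \<open>Descent of the action to the quotient ring\<close>

lemma free_alg_simps [simp]:
  "p \<otimes>\<^bsub>free_alg n\<^esub> q = p * q" "p \<oplus>\<^bsub>free_alg n\<^esub> q = p + q" "\<one>\<^bsub>free_alg n\<^esub> = 1" "\<zero>\<^bsub>free_alg n\<^esub> = 0"
  by (simp_all add: free_alg_def)

lemma carrier_free_alg:
  "p \<in> carrier (free_alg n) \<longleftrightarrow> (\<forall>v \<in> Poly_Mapping.keys p. set (letters v) \<subseteq> gens_D n)"
  by (simp add: free_alg_def)

lemma zero_carrier [simp]: "0 \<in> carrier (free_alg n)"
  by (simp add: carrier_free_alg)

lemma one_carrier [simp]: "1 \<in> carrier (free_alg n)"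
  by (simp add: carrier_free_alg)

lemma plus_carrier [simp]:
  "p \<in> carrier (free_alg n) \<Longrightarrow> q \<in> carrier (free_alg n) \<Longrightarrow> p + q \<in> carrier (free_alg n)"
  using keys_add[of p q] by (auto simp: carrier_free_alg)

lemma uminus_carrier [simp]: "p \<in> carrier (free_alg n) \<Longrightarrow> - p \<in> carrier (free_alg n)"
  by (simp add: carrier_free_alg)

lemma minus_carrier [simp]:
  "p \<in> carrier (free_alg n) \<Longrightarrow> q \<in> carrier (free_alg n) \<Longrightarrow> p - q \<in> carrier (free_alg n)"
  using plus_carrier[of p n "- q"] by simp

lemma mult_carrier [simp]:
  "p \<in> carrier (free_alg n) \<Longrightarrow> q \<in> carrier (free_alg n) \<Longrightarrow> p * q \<in> carrier (free_alg n)"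
  using keys_mult[of p q] by (fastforce simp: carrier_free_alg)

lemma sum_carrier [simp]:
  "(\<And>i. i \<in> I \<Longrightarrow> p i \<in> carrier (free_alg n)) \<Longrightarrow> (\<Sum>i\<in>I. p i) \<in> carrier (free_alg n)"
  by (induction I rule: infinite_finite_induct) auto

lemma const_carrier [simp]: "const c \<in> carrier (free_alg n)"
  by (simp add: carrier_free_alg const_def)

lemma monomial_carrier [simp]: "set ds \<subseteq> gens_D n \<Longrightarrow> monomial ds \<in> carrier (free_alg n)"
  by (simp add: carrier_free_alg monomial_def)

lemma ring_free_alg: "ring (free_alg n :: (gen free_word \<Rightarrow>\<^sub>0 'r::comm_ring_1) ring)"
proof (rule ringI)
  show "abelian_group (free_alg n :: (gen free_word \<Rightarrow>\<^sub>0 'r) ring)"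
  proof (rule abelian_groupI)
    fix p :: "gen free_word \<Rightarrow>\<^sub>0 'r"
    assume "p \<in> carrier (free_alg n)"
    then show "\<exists>q \<in> carrier (free_alg n). q \<oplus>\<^bsub>free_alg n\<^esub> p = \<zero>\<^bsub>free_alg n\<^esub>"
      by (intro bexI[of _ "- p"]) auto
  qed (auto simp: algebra_simps)
  show "Group.monoid (free_alg n :: (gen free_word \<Rightarrow>\<^sub>0 'r) ring)"
    by (rule monoidI) (auto simp: mult.assoc)
qed (auto simp: algebra_simps)

text \<open>The annihilator of the module within rank \<open>n\<close>. It is an ideal containing
  the relators, hence it contains \<open>rel_ideal\<close>; this is how the action becomes well
  defined on classes.\<close>

definition act_kernel :: "'r::comm_ring_1 \<Rightarrow> nat \<Rightarrow> (gen free_word \<Rightarrow>\<^sub>0 'r) set" where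
  "act_kernel \<beta> n = {p \<in> carrier (free_alg n). \<forall>f. act \<beta> p f = (\<lambda>w. 0)}"

lemma act_zero_fun: "act \<beta> p (\<lambda>w. 0) = (\<lambda>w. 0)"
  by (rule ext) (simp add: act_def wop_0)

lemma ideal_act_kernel: "ideal (act_kernel \<beta> n) (free_alg n)"
proof (rule idealI[OF ring_free_alg])
  interpret ring "free_alg n :: (gen free_word \<Rightarrow>\<^sub>0 'a) ring" by (rule ring_free_alg)
  show "subgroup (act_kernel \<beta> n) (add_monoid (free_alg n))"
  proof
    fix p assume p: "p \<in> act_kernel \<beta> n"
    then have "\<ominus>\<^bsub>free_alg n\<^esub> p = - p"
      by (intro minus_equality) (auto simp: act_kernel_def)
    then show "inv\<^bsub>add_monoid (free_alg n)\<^esub> p \<in> act_kernel \<beta> n"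
      using p by (auto simp: a_inv_def act_kernel_def act_uminus fun_eq_iff)
  qed (auto simp: act_kernel_def act_plus fun_eq_iff)
qed (auto simp: act_kernel_def act_mult act_zero_fun)

lemma alternating_simps: "alternating s t 2 = [s, t]" "alternating s t 3 = [s, t, s]"
  by (simp_all add: alternating_def numeral_2_eq_2 numeral_3_eq_3)

lemma alternating_cases:
  assumes "s \<in> gens_D n" "t \<in> gens_D n" "s \<noteq> t"
  obtains "far s t" "alternating s t (coxeter_m s t) = [s, t]" "alternating t s (coxeter_m s t) = [t, s]"
  | "adj s t" "alternating s t (coxeter_m s t) = [s, t, s]" "alternating t s (coxeter_m s t) = [t, s, t]"
  using adj_or_far[OF gens_D_valid[OF assms(1)] gens_D_valid[OF assms(2)] assms(3)]
  by (auto simp: coxeter_m_far coxeter_m_adj alternating_simps)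

lemma relators_subset: "relators \<beta> n \<subseteq> act_kernel \<beta> n"
proof
  fix p assume "p \<in> relators \<beta> n"
  then consider (square) s where "s \<in> gens_D n" "p = monomial [s, s] - const \<beta> * monomial [s]"
    | (braid) s t where "s \<in> gens_D n" "t \<in> gens_D n" "s \<noteq> t"
      "p = monomial (alternating s t (coxeter_m s t)) - monomial (alternating t s (coxeter_m s t))"
    unfolding relators_def by blast
  then show "p \<in> act_kernel \<beta> n"
  proof cases
    case square
    then show ?thesis
      using gens_D_valid[OF square(1)]
      by (auto simp: act_kernel_def act_minus act_mult uop_uop fun_eq_iff)
  next
    case braid
    show ?thesis
    proof (cases rule: alternating_cases[OF braid(1-3)])
      case 1
      then show ?thesis using braid uop_far[OF 1(1), of \<beta>] by (auto simp: act_kernel_def act_minus)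
    next
      case 2
      then show ?thesis using braid uop_adj[OF 2(1), of \<beta>] by (auto simp: act_kernel_def act_minus)
    qed
  qed
qed

lemma ideal_rel_ideal: "ideal (rel_ideal \<beta> n) (free_alg n)"
  unfolding rel_ideal_def
  using relators_subset by (intro ring.genideal_ideal[OF ring_free_alg]) (auto simp: act_kernel_def)

lemma relators_in_rel_ideal: "relators \<beta> n \<subseteq> rel_ideal \<beta> n"
  unfolding rel_ideal_def
  using relators_subset by (intro ring.genideal_self[OF ring_free_alg]) (auto simp: act_kernel_def)

lemma act_rel_ideal: "p \<in> rel_ideal \<beta> n \<Longrightarrow> act \<beta> p f = (\<lambda>w. 0)"
  using ring.genideal_minimal[OF ring_free_alg ideal_act_kernel relators_subset]
  by (auto simp: rel_ideal_def act_kernel_def)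

lemma ring_id_cox: "ring (id_cox \<beta> n)"
  unfolding id_cox_def by (rule ideal.quotient_is_ring[OF ideal_rel_ideal])

lemma cls_ring_hom: "ring_hom_ring (free_alg n) (id_cox \<beta> n) (cls \<beta> n)"
  using ideal.rcos_ring_hom_ring[OF ideal_rel_ideal[of \<beta> n]]
  by (simp add: id_cox_def cls_def[abs_def])

lemma cls_carrier [simp]: "p \<in> carrier (free_alg n) \<Longrightarrow> cls \<beta> n p \<in> carrier (id_cox \<beta> n)"
  using ring_hom_ring.homh[OF cls_ring_hom] by (rule ring_hom_closed)

lemma cls_mult:
  "p \<in> carrier (free_alg n) \<Longrightarrow> q \<in> carrier (free_alg n) \<Longrightarrow>
   cls \<beta> n (p * q) = cls \<beta> n p \<otimes>\<^bsub>id_cox \<beta> n\<^esub> cls \<beta> n q"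
  using ring_hom_mult[OF ring_hom_ring.homh[OF cls_ring_hom]] by fastforce

lemma cls_plus:
  "p \<in> carrier (free_alg n) \<Longrightarrow> q \<in> carrier (free_alg n) \<Longrightarrow>
   cls \<beta> n (p + q) = cls \<beta> n p \<oplus>\<^bsub>id_cox \<beta> n\<^esub> cls \<beta> n q"
  using ring_hom_add[OF ring_hom_ring.homh[OF cls_ring_hom]] by fastforce

lemma cls_one: "cls \<beta> n 1 = \<one>\<^bsub>id_cox \<beta> n\<^esub>"
  using ring_hom_one[OF ring_hom_ring.homh[OF cls_ring_hom]] by fastforce

lemma cls_rel_ideal:
  assumes "p \<in> rel_ideal \<beta> n"
  shows "cls \<beta> n p = \<zero>\<^bsub>id_cox \<beta> n\<^esub>"
proof -
  interpret ideal "rel_ideal \<beta> n" "free_alg n" by (rule ideal_rel_ideal)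
  show ?thesis using a_rcos_const[OF assms] by (simp add: cls_def id_cox_def FactRing_def)
qed

lemma cls_eqI:
  assumes "p \<in> carrier (free_alg n)" "q \<in> carrier (free_alg n)" "p - q \<in> rel_ideal \<beta> n"
  shows "cls \<beta> n p = cls \<beta> n q"
proof -
  interpret R: ring "id_cox \<beta> n" by (rule ring_id_cox)
  have "cls \<beta> n p = cls \<beta> n (p - q) \<oplus>\<^bsub>id_cox \<beta> n\<^esub> cls \<beta> n q"
    using cls_plus[of "p - q" n q \<beta>] assms by simp
  then show ?thesis using assms by (simp add: cls_rel_ideal)
qed

lemma cls_eqD:
  assumes "cls \<beta> n p = cls \<beta> n q" "p \<in> carrier (free_alg n)" "q \<in> carrier (free_alg n)"
  shows "act \<beta> p f = act \<beta> q f"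
proof -
  interpret ideal "rel_ideal \<beta> n" "free_alg n" by (rule ideal_rel_ideal)
  have "p \<in> cls \<beta> n q" using a_rcos_self[OF assms(2)] assms(1) by (simp add: cls_def)
  then obtain i where "i \<in> rel_ideal \<beta> n" "p = i + q"
    by (auto simp: cls_def a_r_coset_def' free_alg_def)
  then show ?thesis by (simp add: act_rel_ideal act_plus fun_eq_iff)
qed

section \<open>The basis of the idCoxeter algebra\<close>


text \<open>Congruence modulo \<open>rel_ideal\<close> with membership in the carrier built in, so
  that calculations can be chained on polynomials instead of cosets.\<close>

definition eqv :: "'r::comm_ring_1 \<Rightarrow> nat \<Rightarrow> (gen free_word \<Rightarrow>\<^sub>0 'r) \<Rightarrow> (gen free_word \<Rightarrow>\<^sub>0 'r) \<Rightarrow> bool" where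
  "eqv \<beta> n p q \<longleftrightarrow> p \<in> carrier (free_alg n) \<and> q \<in> carrier (free_alg n) \<and> p - q \<in> rel_ideal \<beta> n"

lemma rel_ideal_closed:
  shows "0 \<in> rel_ideal \<beta> n"
    and "p \<in> rel_ideal \<beta> n \<Longrightarrow> q \<in> rel_ideal \<beta> n \<Longrightarrow> p + q \<in> rel_ideal \<beta> n"
    and "p \<in> rel_ideal \<beta> n \<Longrightarrow> r \<in> carrier (free_alg n) \<Longrightarrow> r * p \<in> rel_ideal \<beta> n"
    and "p \<in> rel_ideal \<beta> n \<Longrightarrow> r \<in> carrier (free_alg n) \<Longrightarrow> p * r \<in> rel_ideal \<beta> n"
    and "p \<in> rel_ideal \<beta> n \<Longrightarrow> - p \<in> rel_ideal \<beta> n"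
proof -
  interpret ideal "rel_ideal \<beta> n" "free_alg n" by (rule ideal_rel_ideal)
  show "0 \<in> rel_ideal \<beta> n" using additive_subgroup.zero_closed[OF additive_subgroup_axioms] by simp
  show "p \<in> rel_ideal \<beta> n \<Longrightarrow> q \<in> rel_ideal \<beta> n \<Longrightarrow> p + q \<in> rel_ideal \<beta> n"
    using additive_subgroup.a_closed[OF additive_subgroup_axioms, of p q] by simp
  show l: "p \<in> rel_ideal \<beta> n \<Longrightarrow> r \<in> carrier (free_alg n) \<Longrightarrow> r * p \<in> rel_ideal \<beta> n" for p r
    using I_l_closed[of p r] by simp
  show "p \<in> rel_ideal \<beta> n \<Longrightarrow> r \<in> carrier (free_alg n) \<Longrightarrow> p * r \<in> rel_ideal \<beta> n"
    using I_r_closed[of p r] by simp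
  show "p \<in> rel_ideal \<beta> n \<Longrightarrow> - p \<in> rel_ideal \<beta> n"
    using l[of p "- 1"] by simp
qed

lemma eqv_refl: "p \<in> carrier (free_alg n) \<Longrightarrow> eqv \<beta> n p p"
  by (simp add: eqv_def rel_ideal_closed)

lemma eqv_sym: "eqv \<beta> n p q \<Longrightarrow> eqv \<beta> n q p"
  using rel_ideal_closed(5)[of "p - q" \<beta> n] by (simp add: eqv_def)

lemma eqv_trans [trans]: "eqv \<beta> n p q \<Longrightarrow> eqv \<beta> n q r \<Longrightarrow> eqv \<beta> n p r"
  using rel_ideal_closed(2)[of "p - q" \<beta> n "q - r"] by (simp add: eqv_def)

lemma eqv_plus: "eqv \<beta> n p q \<Longrightarrow> eqv \<beta> n p' q' \<Longrightarrow> eqv \<beta> n (p + p') (q + q')"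
  using rel_ideal_closed(2)[of "p - q" \<beta> n "p' - q'"] by (simp add: eqv_def algebra_simps)

lemma eqv_mult: "eqv \<beta> n p q \<Longrightarrow> eqv \<beta> n p' q' \<Longrightarrow> eqv \<beta> n (p * p') (q * q')"
  using rel_ideal_closed(2)[of "(p - q) * p'" \<beta> n "q * (p' - q')"]
    rel_ideal_closed(3)[of "p' - q'" \<beta> n q] rel_ideal_closed(4)[of "p - q" \<beta> n p']
  by (simp add: eqv_def algebra_simps)

lemma eqv_cls: "eqv \<beta> n p q \<Longrightarrow> cls \<beta> n p = cls \<beta> n q"
  by (simp add: eqv_def cls_eqI)

lemma eqv_square:
  assumes "s \<in> gens_D n"
  shows "eqv \<beta> n (monomial [s, s]) (const \<beta> * monomial [s])"
  using assms relators_in_rel_ideal[of \<beta> n] by (auto simp: eqv_def relators_def)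

lemma eqv_braid:
  assumes "s \<in> gens_D n" "t \<in> gens_D n" "s \<noteq> t"
  shows "far s t \<Longrightarrow> eqv \<beta> n (monomial [s, t]) (monomial [t, s])"
    and "adj s t \<Longrightarrow> eqv \<beta> n (monomial [s, t, s]) (monomial [t, s, t])"
proof -
  have r: "monomial (alternating s t (coxeter_m s t)) - monomial (alternating t s (coxeter_m s t)) \<in> rel_ideal \<beta> n"
    using relators_in_rel_ideal[of \<beta> n] assms by (auto simp: relators_def)
  show "far s t \<Longrightarrow> eqv \<beta> n (monomial [s, t]) (monomial [t, s])"
    using r assms by (simp add: coxeter_m_far alternating_simps eqv_def)
  show "adj s t \<Longrightarrow> eqv \<beta> n (monomial [s, t, s]) (monomial [t, s, t])"
    using r assms by (simp add: coxeter_m_adj alternating_simps eqv_def)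
qed

lemma eqv_append:
  assumes "eqv \<beta> n (monomial ds) (monomial es)" "eqv \<beta> n (monomial ds') (monomial es')"
  shows "eqv \<beta> n (monomial (ds @ ds')) (monomial (es @ es'))"
  using eqv_mult[OF assms] by (simp add: monomial_mult)

lemma adj_neq: "adj s t \<Longrightarrow> s \<noteq> t"
  by (auto simp: adj_def split: gen.splits)

lemma braid_eq_eqv:
  "braid_eq n ds es \<Longrightarrow> set ds \<subseteq> gens_D n \<Longrightarrow>
   set es \<subseteq> gens_D n \<and> eqv \<beta> n (monomial ds) (monomial es)"
proof (induction rule: braid_eq.induct)
  case (braid_refl ds)
  then show ?case by (simp add: eqv_refl)
next
  case (braid_trans ds es fs)
  then show ?case using eqv_trans by blast
next
  case (braid_snoc ds es s)
  then show ?case using eqv_append[of \<beta> n ds es "[s]" "[s]"] by (simp add: eqv_refl)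
next
  case (braid_far s t ds)
  then show ?case
    using eqv_append[of \<beta> n ds ds "[s, t]" "[t, s]"] eqv_braid(1)[of s n t \<beta>]
    by (auto simp: eqv_refl far_def)
next
  case (braid_adj s t ds)
  then show ?case
    using eqv_append[of \<beta> n ds ds "[s, t, s]" "[t, s, t]"] eqv_braid(2)[of s n t \<beta>] adj_neq
    by (auto simp: eqv_refl)
qed

definition red :: "nat \<Rightarrow> (int \<Rightarrow> int) \<Rightarrow> gen list" where
  "red n w = (SOME ds. reduced_word n w ds)"

lemma reduced_word_red: "w \<in> W_D n \<Longrightarrow> reduced_word n w (red n w)"
  unfolding red_def using reduced_word_exists by (rule someI_ex)

lemma red_gens: "w \<in> W_D n \<Longrightarrow> set (red n w) \<subseteq> gens_D n"
  using reduced_word_red by (auto simp: reduced_word_def)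

lemma u_elt_red: "u_elt \<beta> n w = cls \<beta> n (monomial (red n w))"
  by (simp add: u_elt_def red_def)

text \<open>Matsumoto's theorem makes u_w independent of the reduced word picked by
  \<open>SOME\<close>.\<close>

lemma eqv_red:
  assumes "reduced_word n w ds"
  shows "eqv \<beta> n (monomial ds) (monomial (red n w))"
proof -
  have "reduced_word n w (red n w)" by (rule reduced_word_red[OF reduced_word_in_W_D[OF assms]])
  from matsumoto[OF assms this] show ?thesis
    using assms by (auto simp: reduced_word_def dest!: braid_eq_eqv)
qed

text \<open>Read from the identity, every letter of a reduced word is an ascent, so no factor
  \<beta> arises and \<open>f\<close> is evaluated at the endpoint.\<close>

lemma wop_reduced_word:
  "reduced_word n w ds \<Longrightarrow> wop \<beta> ds f id = f w"
proof (induction ds arbitrary: f w rule: rev_induct)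
  case Nil
  then show ?case by (auto simp: reduced_word_def)
next
  case (snoc s ds)
  note r = reduced_word_snocD[OF snoc.prems]
  have v: "valid s" using r(1) by (rule gens_D_valid)
  have sp: "signed_perm w" using snoc.prems by (intro signed_perm_W_D reduced_word_in_W_D)
  have "wop \<beta> (ds @ [s]) f id = uop \<beta> s f (w \<circ> simple_refl s)"
    unfolding wop_append snoc.IH[OF r(2)] by simp
  also have "\<dots> = f (w \<circ> simple_refl s \<circ> simple_refl s)"
    using r(3) sp v by (simp add: uop_def ascent_comp_self del: comp_simple_refl_twice)
  finally show ?case by (simp only: comp_simple_refl_twice[OF v])
qed

lemma eqv_red_mult:
  assumes w: "w \<in> W_D n" and s: "s \<in> gens_D n"
  shows "eqv \<beta> n (monomial (red n w) * monomial [s])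
    (if ascent s w then monomial (red n (w \<circ> simple_refl s)) else const \<beta> * monomial (red n w))"
proof (cases "ascent s w")
  case True
  then show ?thesis
    using eqv_red[OF reduced_word_snoc[OF reduced_word_red[OF w] s True], of \<beta>]
    by (simp add: monomial_mult)
next
  case False
  \<comment> \<open>At a descent \<open>w\<close> has a reduced word ending in \<open>s\<close>;
    multiplying it by \<open>s\<close> meets the quadratic relation.\<close>
  obtain cs where cs: "reduced_word n (w \<circ> simple_refl s) cs"
    using reduced_word_exists[OF W_D_comp[OF w s]] by blast
  have g: "set cs \<subseteq> gens_D n" using cs by (simp add: reduced_word_def)
  have red: "eqv \<beta> n (monomial (cs @ [s])) (monomial (red n w))"
    by (rule eqv_red[OF descent_reduced_word[OF w s False cs]])
  have ms: "monomial [s] \<in> carrier (free_alg n)" using s by simp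
  have "eqv \<beta> n (monomial (red n w) * monomial [s]) (monomial (cs @ [s]) * monomial [s])"
    by (rule eqv_mult[OF eqv_sym[OF red] eqv_refl[OF ms]])
  also have "monomial (cs @ [s]) * monomial [s] = (monomial cs * monomial [s, s] :: gen free_word \<Rightarrow>\<^sub>0 'a)"
    by (simp add: monomial_mult)
  also have "eqv \<beta> n \<dots> (monomial cs * (const \<beta> * monomial [s]))"
    using g by (intro eqv_mult eqv_square[OF s] eqv_refl) simp
  also have "monomial cs * (const \<beta> * monomial [s]) = const \<beta> * monomial (cs @ [s])"
    by (simp only: const_commute[of "monomial cs"] monomial_mult[symmetric] mult.assoc[symmetric])
  also have "eqv \<beta> n \<dots> (const \<beta> * monomial (red n w))"
    by (intro eqv_mult red eqv_refl) simp
  finally show ?thesis using False by simp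
qed

text \<open>The spanning half of the basis theorem. The scalar stays existential here;
  \<open>eqv_normal_form\<close> recovers it from the action.\<close>

lemma eqv_monomial:
  assumes "set ds \<subseteq> gens_D n"
  shows "\<exists>c. \<exists>w \<in> W_D n. eqv \<beta> n (monomial ds) (const c * monomial (red n w))"
  using assms
proof (induction ds rule: rev_induct)
  case Nil
  have "reduced_word n id []" using len_D_le[of "[]" n] by (simp add: reduced_word_def)
  from eqv_red[OF this, of \<beta>] have "eqv \<beta> n (monomial []) (const 1 * monomial (red n id))"
    by (simp add: const_def)
  then show ?case using id_in_W_D by blast
next
  case (snoc s ds)
  then obtain c w where w: "w \<in> W_D n" and c: "eqv \<beta> n (monomial ds) (const c * monomial (red n w))"
    by auto
  have s: "s \<in> gens_D n" using snoc.prems by simp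
  have ms: "monomial [s] \<in> carrier (free_alg n)" using s by simp
  define q where "q = (if ascent s w then monomial (red n (w \<circ> simple_refl s)) else const \<beta> * monomial (red n w))"
  have "eqv \<beta> n (monomial ds * monomial [s]) (const c * monomial (red n w) * monomial [s])"
    by (rule eqv_mult[OF c eqv_refl[OF ms]])
  also have "const c * monomial (red n w) * monomial [s] = const c * (monomial (red n w) * monomial [s])"
    by (simp add: mult.assoc)
  also have "eqv \<beta> n \<dots> (const c * q)"
    unfolding q_def by (intro eqv_mult eqv_red_mult[OF w s] eqv_refl) simp
  finally have e: "eqv \<beta> n (monomial (ds @ [s])) (const c * q)" by (simp add: monomial_mult)
  show ?case
  proof (cases "ascent s w")
    case True
    then show ?thesis using e W_D_comp[OF w s] by (auto simp: q_def)
  next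
    case False
    then have "const c * q = const (c * \<beta>) * monomial (red n w)"
      by (simp add: q_def const_mult flip: mult.assoc)
    then show ?thesis using e w by auto
  qed
qed

section \<open>Normal forms and coefficients\<close>

definition delta :: "(int \<Rightarrow> int) \<Rightarrow> (int \<Rightarrow> int) \<Rightarrow> 'r::comm_ring_1" where
  "delta w v = (if v = w then 1 else 0)"

lemma act_red: "w \<in> W_D n \<Longrightarrow> act \<beta> (monomial (red n w)) f id = f w"
  using wop_reduced_word[OF reduced_word_red] by simp

definition normal_form ::
  "nat \<Rightarrow> ((int \<Rightarrow> int) \<Rightarrow> 'r) \<Rightarrow> gen free_word \<Rightarrow>\<^sub>0 'r::comm_ring_1" where
  "normal_form n c = (\<Sum>w\<in>W_D n. const (c w) * monomial (red n w))"

lemma normal_form_carrier [simp]: "normal_form n c \<in> carrier (free_alg n)"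
  unfolding normal_form_def by (intro sum_carrier mult_carrier const_carrier monomial_carrier red_gens)

lemma act_normal_form:
  fixes c :: "(int \<Rightarrow> int) \<Rightarrow> 'r::comm_ring_1"
  assumes "n \<ge> 2" "w \<in> W_D n"
  shows "act \<beta> (normal_form n c) (delta w) id = c w"
proof -
  have "act \<beta> (normal_form n c) (delta w) id = (\<Sum>v\<in>W_D n. c v * delta w v)"
    unfolding normal_form_def act_sum
    by (intro sum.cong refl) (simp add: act_mult act_red del: act_monomial)
  also have "\<dots> = (\<Sum>v\<in>W_D n. if v = w then c v else 0)"
    by (intro sum.cong) (auto simp: delta_def)
  also have "\<dots> = c w" using finite_W_D[OF assms(1)] assms(2) by simp
  finally show ?thesis .
qed

text \<open>Each word is congruent to a multiple of one u_w. Since the action is constant on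
  classes, evaluating indicator functions at the identity determines that multiple; linearity does
  the rest.\<close>

lemma eqv_normal_form:
  assumes "n \<ge> 2" "p \<in> carrier (free_alg n)"
  shows "eqv \<beta> n p (normal_form n (\<lambda>w. act \<beta> p (delta w) id))"
  using assms(2)
proof (induction p rule: poly_mapping_single_induct)
  case zero
  have "normal_form n (\<lambda>w. act \<beta> 0 (delta w) id) = 0" by (simp add: normal_form_def const_def)
  then show ?case by (simp only:) (rule eqv_refl, simp)
next
  case (single v c p)
  let ?N = "\<lambda>p. normal_form n (\<lambda>w. act \<beta> p (delta w) id)"
  have keys: "Poly_Mapping.keys (Poly_Mapping.single v c + p) = insert v (Poly_Mapping.keys p)"
    using single(1,2) by (auto simp: in_keys_iff lookup_add lookup_single when_def split: if_splits)
  have p: "p \<in> carrier (free_alg n)" and v: "set (letters v) \<subseteq> gens_D n"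
    using single.prems by (auto simp: carrier_free_alg keys)
  have vc: "Poly_Mapping.single v c = const c * monomial (letters v)"
    by (simp add: const_def monomial_def mult_single)
  obtain d w where w: "w \<in> W_D n" and d: "eqv \<beta> n (monomial (letters v)) (const d * monomial (red n w))"
    using eqv_monomial[OF v] by blast
  have "eqv \<beta> n (const c * monomial (letters v)) (const c * (const d * monomial (red n w)))"
    by (intro eqv_mult d eqv_refl) simp
  also have e: "const c * (const d * monomial (red n w)) = const (c * d) * monomial (red n w)"
    by (simp add: const_mult flip: mult.assoc)
  finally have 1: "eqv \<beta> n (Poly_Mapping.single v c) (const (c * d) * monomial (red n w))"
    by (simp only: vc e)
  have 2: "const (c * d) * monomial (red n w) = ?N (Poly_Mapping.single v c)"
  proof -
    have "act \<beta> (Poly_Mapping.single v c) f = act \<beta> (const (c * d) * monomial (red n w)) f" for f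
      using eqv_cls[OF 1] 1 by (intro cls_eqD) (auto simp: eqv_def)
    then have "act \<beta> (Poly_Mapping.single v c) (delta u) id = (if u = w then c * d else 0)"
      if "u \<in> W_D n" for u
      by (simp add: act_mult act_red[OF w] delta_def del: act_monomial)
    then have "?N (Poly_Mapping.single v c) =
        (\<Sum>u\<in>W_D n. if u = w then const (c * d) * monomial (red n u) else 0)"
      unfolding normal_form_def by (intro sum.cong) (auto simp: const_def)
    then show ?thesis using finite_W_D[OF assms(1)] w by simp
  qed
  have 3: "?N (Poly_Mapping.single v c + p) = ?N (Poly_Mapping.single v c) + ?N p"
    by (simp add: normal_form_def act_plus const_plus distrib_right sum.distrib)
  show ?case unfolding 3 by (rule eqv_plus[OF 1[unfolded 2] single.IH[OF p]])
qed

text \<open>Faithfulness of the action: equations in the quotient may be verified on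
  operators.\<close>

lemma cls_eq_iff:
  assumes "n \<ge> 2" "p \<in> carrier (free_alg n)" "q \<in> carrier (free_alg n)"
  shows "cls \<beta> n p = cls \<beta> n q \<longleftrightarrow>
    (\<forall>w \<in> W_D n. act \<beta> p (delta w) id = act \<beta> q (delta w) id)"
proof
  assume "cls \<beta> n p = cls \<beta> n q"
  then show "\<forall>w \<in> W_D n. act \<beta> p (delta w) id = act \<beta> q (delta w) id"
    using cls_eqD assms(2,3) by metis
next
  assume "\<forall>w \<in> W_D n. act \<beta> p (delta w) id = act \<beta> q (delta w) id"
  then have "normal_form n (\<lambda>w. act \<beta> p (delta w) id) = normal_form n (\<lambda>w. act \<beta> q (delta w) id)"
    by (simp add: normal_form_def)
  then show "cls \<beta> n p = cls \<beta> n q"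
    using eqv_cls[OF eqv_normal_form[OF assms(1,2), of \<beta>]]
      eqv_cls[OF eqv_normal_form[OF assms(1,3), of \<beta>]] by simp
qed

lemma smult_u_cls:
  "w \<in> W_D n \<Longrightarrow> smult_u \<beta> n c w = cls \<beta> n (const c * monomial (red n w))"
  by (simp add: smult_u_def u_elt_red cls_mult red_gens)

lemma finsum_cls:
  assumes "finite I" "\<And>i. i \<in> I \<Longrightarrow> p i \<in> carrier (free_alg n)"
  shows "(\<Oplus>\<^bsub>id_cox \<beta> n\<^esub>i\<in>I. cls \<beta> n (p i)) = cls \<beta> n (\<Sum>i\<in>I. p i)"
proof -
  interpret R: ring "id_cox \<beta> n" by (rule ring_id_cox)
  show ?thesis
    using assms
  proof (induction I)
    case empty
    then show ?case by (simp add: cls_rel_ideal rel_ideal_closed(1))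
  next
    case (insert i I)
    then show ?case
      by (subst R.finsum_insert) (auto simp: cls_plus)
  qed
qed

lemma finsum_smult_u:
  assumes "n \<ge> 2"
  shows "(\<Oplus>\<^bsub>id_cox \<beta> n\<^esub>w\<in>W_D n. smult_u \<beta> n (c w) w) = cls \<beta> n (normal_form n c)"
proof -
  interpret R: ring "id_cox \<beta> n" by (rule ring_id_cox)
  have "(\<Oplus>\<^bsub>id_cox \<beta> n\<^esub>w\<in>W_D n. smult_u \<beta> n (c w) w) =
      (\<Oplus>\<^bsub>id_cox \<beta> n\<^esub>w\<in>W_D n. cls \<beta> n (const (c w) * monomial (red n w)))"
    by (rule R.finsum_cong') (auto simp: smult_u_cls red_gens)
  then show ?thesis
    using finsum_cls[OF finite_W_D[OF assms], of "\<lambda>w. const (c w) * monomial (red n w)" n \<beta>]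
    by (simp add: normal_form_def red_gens)
qed

text \<open>Existence for the definite description is \<open>eqv_normal_form\<close>, entering
  through \<open>cls_eq_iff\<close>; uniqueness is the linear independence expressed by
  \<open>act_normal_form\<close>.\<close>

lemma u_coeff_cls:
  assumes n: "n \<ge> 2" and p: "p \<in> carrier (free_alg n)" and w: "w \<in> W_D n"
  shows "u_coeff \<beta> n (cls \<beta> n p) w = act \<beta> p (delta w) id"
proof -
  define C where "C w = (if w \<in> W_D n then act \<beta> p (delta w) id else 0)" for w
  have "u_coeff \<beta> n (cls \<beta> n p) = C"
    unfolding u_coeff_def finsum_smult_u[OF n]
  proof (rule the_equality)
    show "(\<forall>w. w \<notin> W_D n \<longrightarrow> C w = 0) \<and> cls \<beta> n p = cls \<beta> n (normal_form n C)"
      using act_normal_form[OF n, of _ \<beta> C] by (auto simp: C_def cls_eq_iff[OF n p])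
    fix c assume c: "(\<forall>w. w \<notin> W_D n \<longrightarrow> c w = 0) \<and> cls \<beta> n p = cls \<beta> n (normal_form n c)"
    show "c = C"
    proof
      fix w
      show "c w = C w"
        using c act_normal_form[OF n, of w \<beta> c] by (auto simp: C_def cls_eq_iff[OF n p])
    qed
  qed
  then show ?thesis using w by (simp add: C_def)
qed

text \<open>The exponent in \<open>demazure\<close> is 1 here, so the condition reads u_w u_s =
  \<beta> u_w. At an ascent the left side is the different basis element with index w s, so the
  equation fails for every \<beta>, also for 0.\<close>

lemma demazure_simple_refl_iff:
  fixes \<beta> :: "'r::comm_ring_1"
  assumes n: "n \<ge> 2" and w: "w \<in> W_D n" and s: "s \<in> gens_D n"
  shows "demazure \<beta> n w (simple_refl s) w \<longleftrightarrow> \<not> ascent s w"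
proof -
  note rs = reduced_word_simple_refl[OF s]
  have l: "len_D n (simple_refl s) = 1" using rs by (simp add: reduced_word_def)
  have g: "(monomial (red n w) :: gen free_word \<Rightarrow>\<^sub>0 'r) \<in> carrier (free_alg n)"
    "(monomial [s] :: gen free_word \<Rightarrow>\<^sub>0 'r) \<in> carrier (free_alg n)"
    using red_gens[OF w] s by simp_all
  have u: "u_elt \<beta> n (simple_refl s) = cls \<beta> n (monomial [s])"
    unfolding u_elt_red by (rule eqv_cls[OF eqv_red[OF rs], symmetric])
  have "demazure \<beta> n w (simple_refl s) w \<longleftrightarrow>
      cls \<beta> n (monomial (red n w) * monomial [s]) = cls \<beta> n (const \<beta> * monomial (red n w))"
    using w g by (simp add: demazure_def u u_elt_red[of _ _ w] smult_u_cls l cls_mult)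
  also have "\<dots> \<longleftrightarrow> (\<forall>v \<in> W_D n. uop \<beta> s (delta v) w = \<beta> * delta v w)"
    using g by (subst cls_eq_iff[OF n]) (simp_all add: act_mult act_red[OF w] act_monomial[of \<beta> "[s]"] del: act_monomial)
  also have "\<dots> \<longleftrightarrow> \<not> ascent s w"
  proof
    assume a: "\<not> ascent s w"
    then show "\<forall>v \<in> W_D n. uop \<beta> s (delta v) w = \<beta> * delta v w"
      using signed_perm_W_D[OF w] by (simp add: uop_def)
  next
    assume *: "\<forall>v \<in> W_D n. uop \<beta> s (delta v) w = \<beta> * delta v w"
    show "\<not> ascent s w"
    proof
      assume a: "ascent s w"
      have "w \<circ> simple_refl s \<noteq> w"
        using a ascent_comp_self[OF gens_D_valid[OF s] signed_perm_W_D[OF w]] by metis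
      then have "uop \<beta> s (delta (w \<circ> simple_refl s)) w = 1" "delta (w \<circ> simple_refl s) w = (0::'r)"
        using a signed_perm_W_D[OF w] by (auto simp: uop_def delta_def)
      then show False using * W_D_comp[OF w s] by fastforce
    qed
  qed
  finally show ?thesis .
qed

section \<open>The double Grothendieck polynomials\<close>


definition hpoly :: "(gen \<times> 'r) list \<Rightarrow> gen free_word \<Rightarrow>\<^sub>0 'r::comm_ring_1" where
  "hpoly l = foldr (\<lambda>(s, t) p. (1 + const t * monomial [s]) * p) l 1"

lemma hpoly_Nil [simp]: "hpoly [] = 1"
  and hpoly_Cons [simp]: "hpoly ((s, t) # l) = (1 + const t * monomial [s]) * hpoly l"
  by (simp_all add: hpoly_def)

lemma hpoly_append: "hpoly (l @ l') = hpoly l * hpoly l'"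
  by (induction l) (auto simp: mult.assoc)

lemma act_hpoly: "act \<beta> (hpoly l) f = hops \<beta> l f"
proof (induction l)
  case (Cons p l)
  obtain s t where p: "p = (s, t)" by (cases p)
  show ?case by (rule ext) (simp add: p act_mult act_plus Cons.IH hop_def)
qed simp

lemma hpoly_carrier: "fst ` set l \<subseteq> gens_D n \<Longrightarrow> hpoly l \<in> carrier (free_alg n)"
  by (induction l) auto

lemma h_elt_cls: "s \<in> gens_D n \<Longrightarrow> h_elt \<beta> n s x = cls \<beta> n (hpoly [(s, x)])"
  by (simp add: h_elt_def cls_plus cls_mult cls_one)

lemma list_prod_cls:
  assumes "\<And>x. x \<in> set xs \<Longrightarrow> fst ` set (L x) \<subseteq> gens_D n \<and> F x = cls \<beta> n (hpoly (L x))"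
  shows "list_prod (id_cox \<beta> n) (map F xs) = cls \<beta> n (hpoly (concat (map L xs)))"
  using assms
proof (induction xs)
  case Nil
  then show ?case by (simp add: list_prod_def cls_one)
next
  case (Cons x xs)
  have "fst ` set (concat (map L xs)) \<subseteq> gens_D n" using Cons.prems by auto
  then show ?case
    using Cons by (simp add: list_prod_def hpoly_append cls_mult hpoly_carrier)
qed

lemma A_elt_cls:
  assumes "i \<ge> 1"
  shows "A_elt \<beta> n i x = cls \<beta> n (hpoly (downs (map S [i..<n]) x))"
proof -
  have "A_elt \<beta> n i x = cls \<beta> n (hpoly (concat (map (\<lambda>k. [(S k, x)]) (rev [i..<n]))))"
    unfolding A_elt_def
  proof (rule list_prod_cls)
    fix k assume "k \<in> set (rev [i..<n])"
    then have "S k \<in> gens_D n" using assms by (auto simp: gens_D_def)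
    then show "fst ` set [(S k, x)] \<subseteq> gens_D n \<and> h_elt \<beta> n (S k) x = cls \<beta> n (hpoly [(S k, x)])"
      by (simp only: h_elt_cls) simp
  qed
  then show ?thesis by (simp add: downs_def rev_map comp_def)
qed

lemma G_list_concat:
  assumes "i \<le> n"
  shows "G_list (map S [i..<n]) (\<lambda>k. a (i + k)) = concat (map (\<lambda>i. downs (map S [i..<n]) (a i)) [i..<n])"
  using assms
proof (induction "n - i" arbitrary: i)
  case (Suc k)
  then have *: "[i..<n] = i # [Suc i..<n]" by (simp add: upt_conv_Cons)
  have c: "(\<lambda>k. a (i + k)) \<circ> Suc = (\<lambda>k. a (Suc i + k))" by (rule ext) simp
  have "G_list (map S [Suc i..<n]) (\<lambda>k. a (Suc i + k)) =
      concat (map (\<lambda>i. downs (map S [i..<n]) (a i)) [Suc i..<n])"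
    using Suc by (intro Suc.hyps(1)) auto
  then show ?case unfolding * list.map G_list.simps c by (simp add: *)
qed simp

lemma G_A_cls:
  assumes "n \<ge> 1"
  shows "G_A \<beta> n a = cls \<beta> n (hpoly (G_list (map S [1..<n]) (\<lambda>k. a (1 + k))))"
  unfolding G_A_def G_list_concat[OF assms]
  by (rule list_prod_cls) (auto simp: A_elt_cls downs_def gens_D_def)

lemma F_list_gens: "fst ` set (F_list n x) \<subseteq> gens_D n"
  by (auto simp: F_list_def gens_D_def)

lemma F_D1_cls: "F_D1 \<beta> n x = cls \<beta> n (hpoly (F_list n x))"
proof -
  let ?gs = "map S (rev [1..<n]) @ [Hat] @ map S [2..<n]"
  have "F_D1 \<beta> n x = cls \<beta> n (hpoly (concat (map (\<lambda>s. [(s, x)]) ?gs)))"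
    unfolding F_D1_def
  proof (rule list_prod_cls)
    fix s assume "s \<in> set ?gs"
    then have "s \<in> gens_D n" by (auto simp: gens_D_def)
    then show "fst ` set [(s, x)] \<subseteq> gens_D n \<and> h_elt \<beta> n s x = cls \<beta> n (hpoly [(s, x)])"
      by (simp only: h_elt_cls) simp
  qed
  then show ?thesis by (simp add: F_list_def comp_def)
qed

lemma F_D_cls: "F_D \<beta> n x = cls \<beta> n (hpoly (concat (map (\<lambda>i. F_list n (x i)) [1..<n + 1])))"
  unfolding F_D_def by (rule list_prod_cls) (rule conjI[OF F_list_gens F_D1_cls])

section \<open>Inverse of the type A factor\<close>

lemma ups_downs_inverse:
  assumes "\<forall>g \<in> set gs. valid g" "fg_add \<beta> b c = 0"
  shows "hops \<beta> (ups gs b) (hops \<beta> (downs gs c) f) = f"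
    and "hops \<beta> (downs gs c) (hops \<beta> (ups gs b) f) = f"
  using assms(1)
proof (induction gs arbitrary: f)
  case (Cons g gs)
  { case 1 then show ?case using Cons.IH(1) assms(2) by (simp add: hop_hop) }
  { case 2 then show ?case using Cons.IH(2) assms(2) by (simp add: hop_hop fg_add_commute[of _ c]) }
qed simp_all

text \<open>Both orders are proved, since \<open>inv_char\<close> asks for a two-sided inverse in a
  noncommutative ring.\<close>

lemma inv_G_list_inverse:
  assumes "\<forall>g \<in> set gs. valid g" "\<And>k. fg_add \<beta> (b k) (c k) = 0"
  shows "hops \<beta> (inv_G_list gs b) (hops \<beta> (G_list gs c) f) = f"
    and "hops \<beta> (G_list gs c) (hops \<beta> (inv_G_list gs b) f) = f"
  using assms
proof (induction gs arbitrary: b c f)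
  case (Cons g gs)
  { case 1
    have "hops \<beta> (inv_G_list gs (b \<circ> Suc)) (hops \<beta> (G_list gs (c \<circ> Suc)) f) = f"
      by (rule Cons.IH(1)) (use 1 in auto)
    then show ?case
      using ups_downs_inverse(1)[of "g # gs" \<beta> "b 0" "c 0"] 1
      by (simp del: ups_simps downs_simps) }
  { case 2
    have "hops \<beta> (G_list gs (c \<circ> Suc)) (hops \<beta> (inv_G_list gs (b \<circ> Suc)) f) = f" for f
      by (rule Cons.IH(2)) (use 2 in auto)
    then show ?case
      using ups_downs_inverse(2)[of "g # gs" \<beta> "b 0" "c 0"] 2
      by (simp del: ups_simps downs_simps) }
qed simp_all

lemma fg_add_fg_neg: "1 + \<beta> * y \<noteq> 0 \<Longrightarrow> fg_add \<beta> y (fg_neg \<beta> y) = 0"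
  by (simp add: fg_add_def fg_neg_def field_simps)

lemma in_inv_G_list: "(s, t) \<in> set (inv_G_list gs b) \<Longrightarrow> s \<in> set gs"
  by (induction gs arbitrary: b) auto

section \<open>The generating product as a single list of factors\<close>

definition groth_list ::
  "nat \<Rightarrow> (nat \<Rightarrow> 'r) \<Rightarrow> (nat \<Rightarrow> 'r) \<Rightarrow> (nat \<Rightarrow> 'r) \<Rightarrow> (gen \<times> 'r) list" where
  "groth_list n a b x =
     inv_G_list (map S [1..<n]) (\<lambda>k. b (1 + k)) @ concat (map (\<lambda>i. F_list n (x i)) [1..<n + 1]) @
     G_list (map S [1..<n]) (\<lambda>k. a (1 + k))"

lemma G_list_gens:
  "fst ` set (G_list (map S [1..<n]) y) \<subseteq> gens_D n"
  "fst ` set (inv_G_list (map S [1..<n]) y) \<subseteq> gens_D n"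
  by (auto simp: gens_D_def dest!: in_G_list in_inv_G_list)

lemma F_lists_gens: "fst ` set (concat (map (\<lambda>i. F_list n (x i)) is)) \<subseteq> gens_D n"
  using F_list_gens by fastforce

lemma double_groth_D_hops:
  fixes \<beta> :: "'r::field"
  assumes n: "n \<ge> 2" and w: "w \<in> W_D n" and b: "\<And>i. 1 + \<beta> * b i \<noteq> 0"
  shows "double_groth_D \<beta> n w a b x = hops \<beta> (groth_list n a b x) (delta w) id"
proof -
  interpret R: ring "id_cox \<beta> n" by (rule ring_id_cox)
  let ?gs = "map S [1..<n]" and ?c = "\<lambda>k. fg_neg \<beta> (b (1 + k))" and ?b = "\<lambda>k. b (1 + k)"
  let ?F = "concat (map (\<lambda>i. F_list n (x i)) [1..<n + 1])" and ?G = "G_list ?gs (\<lambda>k. a (1 + k))"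
  have v: "\<forall>g \<in> set ?gs. valid g" by (auto simp: valid_def)
  note inv = inv_G_list_inverse[OF v, of \<beta> ?b ?c, OF fg_add_fg_neg[OF b]]
  define P Q F G where "P = hpoly (inv_G_list ?gs ?b)" and "Q = hpoly (G_list ?gs ?c)"
    and "F = hpoly ?F" and "G = hpoly ?G"
  have car: "P \<in> carrier (free_alg n)" "Q \<in> carrier (free_alg n)" "F \<in> carrier (free_alg n)"
    "G \<in> carrier (free_alg n)"
    unfolding P_def Q_def F_def G_def by (intro hpoly_carrier G_list_gens F_lists_gens)+
  have n1: "1 \<le> n" using n by simp
  have GA: "G_A \<beta> n (\<lambda>i. fg_neg \<beta> (b i)) = cls \<beta> n Q" "G_A \<beta> n a = cls \<beta> n G" "F_D \<beta> n x = cls \<beta> n F"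
    by (simp_all only: G_A_cls[OF n1] F_D_cls Q_def G_def F_def)
  have act: "act \<beta> (P * Q) f = f" "act \<beta> (Q * P) f = f" for f
    unfolding act_mult P_def Q_def act_hpoly by (rule inv)+
  \<comment> \<open>The inverse is checked on operators and carried back to the quotient by
    faithfulness.\<close>
  have "cls \<beta> n (Q * P) = cls \<beta> n 1" "cls \<beta> n (P * Q) = cls \<beta> n 1"
    using car by (simp_all add: cls_eq_iff[OF n] act)
  then have "inv\<^bsub>id_cox \<beta> n\<^esub> (cls \<beta> n Q) = cls \<beta> n P"
    using car by (intro R.inv_char) (simp_all add: cls_mult cls_one)
  then have "double_groth_D \<beta> n w a b x = u_coeff \<beta> n (cls \<beta> n (P * F * G)) w"
    using car by (simp add: double_groth_D_def GA cls_mult)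
  also have "\<dots> = act \<beta> (P * F * G) (delta w) id"
    by (rule u_coeff_cls[OF n _ w]) (use car in simp)
  also have "P * F * G = hpoly (groth_list n a b x)"
    by (simp only: groth_list_def hpoly_append mult.assoc P_def F_def G_def)
  finally show ?thesis by (simp only: act_hpoly)
qed

lemma G_list_cong:
  "(\<And>k. k < length gs \<Longrightarrow> y k = z k) \<Longrightarrow> G_list gs y = G_list gs z"
proof (induction gs arbitrary: y z)
  case (Cons g gs)
  have "G_list gs (y \<circ> Suc) = G_list gs (z \<circ> Suc)"
    by (rule Cons.IH) (simp add: Cons.prems)
  moreover have "y 0 = z 0" by (simp add: Cons.prems)
  ultimately show ?case by simp
qed simp

lemma groth_list_Delta_D:
  fixes \<beta> :: "'r::field"
  assumes m: "m \<ge> 1" "n = 2 * m" and x: "\<And>i. 1 + \<beta> * x i \<noteq> 0"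
  shows "hops \<beta> (groth_list n a b x) f =
    hops \<beta> (map (\<lambda>k. (Delta_D n ! k, wt_D \<beta> n a b x k)) [0..<length (Delta_D n)]) f"
proof -
  have n: "n \<ge> 2" using m by simp
  define p where "p i = (if i \<le> n then x (n + 1 - i) else a (i - n))" for i
  let ?F = "\<lambda>i. F_list n (x i)" and ?gs = "map S [1..<n]"
  let ?rows = "concat (map (\<lambda>i. row_list \<beta> (row_gens n i) (x i) (\<lambda>k. p (n + 2 - i + k)))
        (rev [1..<n + 1]))"
  \<comment> \<open>\<open>F_D\<close> multiplies in the order x_1, ..., x_n, while the rows are
    peeled with F(x_1) next to G, hence the reversal.\<close>
  have rev: "hops \<beta> (concat (map ?F [1..<n + 1])) g = hops \<beta> (concat (map ?F (rev [1..<n + 1]))) g" for g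
    unfolding hops_concat
    by (rule foldr_rev_commute[symmetric]) (rule F_list_commute_field[OF n x])
  have G: "G_list (row_gens n 1) (\<lambda>k. p (n + 1 + k)) = G_list ?gs (\<lambda>k. a (1 + k))"
    using row_gens_odd[OF n, of 1] by (simp add: p_def)
  have G': "G_list (row_gens n (Suc n)) (\<lambda>k. p (n + 1 - n + k)) = G_list ?gs (\<lambda>k. x (n - k))"
  proof -
    \<comment> \<open>Evenness of \<open>n\<close> brings the remaining G back to the branch through
      \<open>S 1\<close>, where \<open>inv_G_list\<close> can meet it.\<close>
    have "odd (Suc n)" using m by simp
    from row_gens_odd[OF n this] show ?thesis
      by (simp only:) (rule G_list_cong, auto simp: p_def)
  qed
  have "hops \<beta> (groth_list n a b x) f = hops \<beta> (inv_G_list ?gs (\<lambda>k. b (1 + k)))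
      (hops \<beta> (concat (map ?F (rev [1..<n + 1]))) (hops \<beta> (G_list ?gs (\<lambda>k. a (1 + k))) f))"
    by (simp only: groth_list_def hops_append rev)
  also have "\<dots> = hops \<beta> (inv_G_list ?gs (\<lambda>k. b (1 + k)))
      (hops \<beta> (G_list ?gs (\<lambda>k. x (n - k))) (hops \<beta> ?rows f))"
    using F_lists_G_list[OF n order_refl, of p x \<beta> f] unfolding G G' by (simp only: p_def if_True)
  also have "\<dots> = hops \<beta> (triangle_list \<beta> ?gs (\<lambda>k. b (1 + k)) (\<lambda>k. x (n - k)) @ ?rows) f"
    using inv_G_list_G_list[OF chain_map_S[of 1 n], of \<beta>] by simp
  also have "triangle_list \<beta> ?gs (\<lambda>k. b (1 + k)) (\<lambda>k. x (n - k)) @ ?rows =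
      zip (Delta_D n) (map (coord_wt \<beta> n a b x) (coords_D n))"
    by (simp only: weighted_Delta_D(2)[OF m] p_def)
  also have "\<dots> = map (\<lambda>k. (Delta_D n ! k, wt_D \<beta> n a b x k)) [0..<length (Delta_D n)]"
    by (rule nth_equalityI) (simp_all add: weighted_Delta_D(1)[OF m] wt_D_def coord_wt_def)
  finally show ?thesis .
qed

lemma Delta_D_gens: "n \<ge> 2 \<Longrightarrow> set (Delta_D n) \<subseteq> gens_D n"
  by (auto simp: Delta_D_def Delta_A_def gens_D_def)

lemma Rsub_red_positions:
  assumes "set ds \<subseteq> gens_D n"
  shows "Rsub n ds w = {J \<in> red_positions n ds. word_prod (nths ds J) = w}"
proof -
  have "length (nths ds J) = card J" if "J \<subseteq> {..<length ds}" for J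
    using that by (auto simp: length_nths intro: arg_cong[where f = card])
  moreover have "set (nths ds J) \<subseteq> gens_D n" for J
    using set_nths_subset[of ds J] assms by blast
  ultimately show ?thesis by (auto simp: Rsub_def red_positions_def reduced_word_def)
qed

lemma B_set_stalls:
  assumes "n \<ge> 2" "set ds \<subseteq> gens_D n"
  shows "B_set \<beta> n ds J = stalls ds J"
proof -
  have W: "word_prod (nths ds K) \<in> W_D n" for K
    using set_nths_subset[of ds K] assms(2) by (intro word_prod_in_W_D) blast
  have "demazure \<beta> n (word_prod (nths ds K)) (simple_refl (ds ! j)) (word_prod (nths ds K)) \<longleftrightarrow>
      \<not> ascent (ds ! j) (word_prod (nths ds K))" if "j < length ds" for j K
    using that assms(2) nth_mem by (intro demazure_simple_refl_iff[OF assms(1) W]) blast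
  then show ?thesis unfolding B_set_def stalls_def by blast
qed

lemma subword_sum:
  assumes n: "n \<ge> 2" and ds: "set ds \<subseteq> gens_D n"
  shows "hops \<beta> (map (\<lambda>k. (ds ! k, t k)) [0..<length ds]) (delta w) id =
    (\<Sum>J \<in> Rsub n ds w. (\<Prod>k\<in>J. t k) * (\<Prod>k\<in>B_set \<beta> n ds J. 1 + \<beta> * t k))"
  unfolding hops_subwords[OF ds] Rsub_red_positions[OF ds] B_set_stalls[OF n ds]
  by (subst sum.inter_filter) (auto simp: delta_def intro!: sum.cong)

theorem double_groth_D_even:
  fixes \<beta> :: "'r::field"
  assumes "m \<ge> 1" "n = 2 * m" "\<And>i. 1 + \<beta> * b i \<noteq> 0" "\<And>i. 1 + \<beta> * x i \<noteq> 0" "w \<in> W_D n"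
  shows "double_groth_D \<beta> n w a b x = (\<Sum>J \<in> Rsub n (Delta_D n) w. Wt_D \<beta> n a b x J)"
proof -
  have n: "n \<ge> 2" using assms(1,2) by simp
  show ?thesis
    unfolding double_groth_D_hops[OF n assms(5,3)] groth_list_Delta_D[OF assms(1,2,4)]
      subword_sum[OF n Delta_D_gens[OF n]] Wt_D_def ..
qed

section \<open>Odd rank\<close>

lemma filter_G_list:
  "\<forall>g \<in> set gs. g \<noteq> h \<Longrightarrow> filter (\<lambda>p. fst p \<noteq> h) (G_list (gs @ [h]) y) = G_list gs y"
  "\<forall>g \<in> set gs. g \<noteq> h \<Longrightarrow> filter (\<lambda>p. fst p \<noteq> h) (inv_G_list (gs @ [h]) y) = inv_G_list gs y"
proof -
  have *: "filter (\<lambda>p. fst p \<noteq> h) (ups gs z) = ups gs z" "filter (\<lambda>p. fst p \<noteq> h) (downs gs z) = downs gs z"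
    if "\<forall>g \<in> set gs. g \<noteq> h" for gs and z :: 'a
    using that by (auto simp: ups_def downs_def)
  have up: "ups (gs @ [h]) z = ups gs z @ [(h, z)]" "downs (gs @ [h]) z = (h, z) # downs gs z"
    for gs and z :: 'a by (simp_all add: ups_def downs_def)
  show "\<forall>g \<in> set gs. g \<noteq> h \<Longrightarrow> filter (\<lambda>p. fst p \<noteq> h) (G_list (gs @ [h]) y) = G_list gs y"
    by (induction gs arbitrary: y) (auto simp: up *)
  show "\<forall>g \<in> set gs. g \<noteq> h \<Longrightarrow> filter (\<lambda>p. fst p \<noteq> h) (inv_G_list (gs @ [h]) y) = inv_G_list gs y"
    by (induction gs arbitrary: y) (auto simp: up *)
qed

lemma filter_F_list:
  assumes "n \<ge> 2"
  shows "filter (\<lambda>p. fst p \<noteq> S n) (F_list (Suc n) x) = F_list n x"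
proof -
  have "filter (\<lambda>i. i \<noteq> n) [k..<n] = [k..<n]" for k by simp
  then show ?thesis using assms by (simp add: F_list_def filter_map comp_def rev_filter[symmetric])
qed

lemma hops_F_list_0: "hops \<beta> (F_list n 0) f = f"
proof -
  have "hops \<beta> (map (\<lambda>s. (s, 0)) gs) f = f" for gs by (induction gs) auto
  then show ?thesis by (simp only: F_list_def)
qed

lemma groth_list_parabolic:
  assumes n: "n \<ge> 2" and w: "w \<in> W_D n" and x: "x' (Suc n) = 0" "\<And>i. i \<le> n \<Longrightarrow> x' i = x i"
  shows "hops \<beta> (groth_list (Suc n) a b x') (delta w) id = hops \<beta> (groth_list n a b x) (delta w) id"
proof -
  let ?gs = "map S [1..<n]"
  let ?F = "concat (map (\<lambda>i. F_list (Suc n) (x' i)) [1..<n + 1])"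
  define l where "l = inv_G_list (?gs @ [S n]) (\<lambda>k. b (1 + k)) @ ?F @ G_list (?gs @ [S n]) (\<lambda>k. a (1 + k))"
  have gs: "map S [1..<Suc n] = ?gs @ [S n]" using n by simp
  have "hops \<beta> (groth_list (Suc n) a b x') (delta w) id = hops \<beta> l (delta w) id"
    unfolding groth_list_def l_def gs by (simp add: x(1) hops_F_list_0)
  also have "\<dots> = hops \<beta> (filter (\<lambda>p. fst p \<noteq> S n) l) (delta w) id"
  proof (rule hops_parabolic[OF n _ _ id_in_W_D])
    show "fst ` set l \<subseteq> gens_D (Suc n)"
      unfolding l_def set_append image_Un
      by (intro Un_least F_lists_gens G_list_gens[of "Suc n", unfolded gs])
    \<comment> \<open>\<open>delta w\<close> is supported at \<open>w\<close>, which fixes n +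
      1.\<close>
    show "delta w v = 0" if "v (int (Suc n)) < int (Suc n)" for v
      using that W_D_fixes[OF w n, of "Suc n"] by (auto simp: delta_def)
  qed
  also have "filter (\<lambda>p. fst p \<noteq> S n) l = groth_list n a b x"
  proof -
    have "filter (\<lambda>p. fst p \<noteq> S n) ?F = concat (map (\<lambda>i. F_list n (x i)) [1..<n + 1])"
      unfolding filter_concat map_map
      by (rule arg_cong[where f = concat], rule map_cong) (auto simp: filter_F_list[OF n] x)
    moreover have "\<forall>g \<in> set ?gs. g \<noteq> S n" by auto
    ultimately show ?thesis by (simp add: l_def groth_list_def filter_G_list del: upt_Suc)
  qed
  finally show ?thesis .
qed

lemma W_D_mono: "W_D n \<subseteq> W_D (Suc n)"
proof
  fix w assume "w \<in> W_D n"
  then obtain ds where "set ds \<subseteq> gens_D n" "w = word_prod ds" by (auto simp: W_D_def)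
  moreover have "gens_D n \<subseteq> gens_D (Suc n)" by (auto simp: gens_D_def)
  ultimately show "w \<in> W_D (Suc n)" using word_prod_in_W_D by blast
qed

theorem double_groth_D_odd:
  fixes \<beta> :: "'r::field"
  assumes m: "m \<ge> 2" and b: "\<And>i. 1 + \<beta> * b i \<noteq> 0" and x: "\<And>i. 1 + \<beta> * x i \<noteq> 0"
    and w: "w \<in> W_D (2 * m - 1)"
  shows "double_groth_D \<beta> (2 * m - 1) w a b x =
    (\<Sum>J \<in> Rsub (2 * m) (Delta_D (2 * m)) w. Wt_D \<beta> (2 * m) a b (x(2 * m := 0)) J)"
proof -
  define n where "n = 2 * m - 1"
  have n: "n \<ge> 2" "Suc n = 2 * m" using m by (simp_all add: n_def)
  have w': "w \<in> W_D n" "w \<in> W_D (Suc n)" using w W_D_mono[of n] by (auto simp: n_def)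
  let ?x = "x(Suc n := 0)"
  have "double_groth_D \<beta> n w a b x = hops \<beta> (groth_list (Suc n) a b ?x) (delta w) id"
    using groth_list_parabolic[OF n(1) w'(1), of ?x x] double_groth_D_hops[OF n(1) w'(1) b] by simp
  also have "\<dots> = double_groth_D \<beta> (Suc n) w a b ?x"
    using double_groth_D_hops[OF _ w'(2) b] n by simp
  also have "\<dots> = (\<Sum>J \<in> Rsub (Suc n) (Delta_D (Suc n)) w. Wt_D \<beta> (Suc n) a b ?x J)"
    by (rule double_groth_D_even[OF _ n(2) b _ w'(2)]) (use m x in auto)
  finally show ?thesis unfolding n(2) by (simp only: n_def)
qed

lemma one_plus_beta_var:
  "1 + beta_var * indet v \<noteq> 0"
proof -
  let ?k = "Poly_Mapping.single Beta 1 + Poly_Mapping.single v (1::nat)"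
  \<comment> \<open>The exponent at \<open>v\<close> is 1, or 2 if \<open>v\<close> is
    \<open>Beta\<close>. So the product is a nonconstant monomial and leaves the constant term 1
    untouched.\<close>
  have "Poly_Mapping.lookup ?k v \<noteq> 0" by (simp add: lookup_add)
  then have "?k \<noteq> 0" by (metis lookup_zero)
  then have "Poly_Mapping.lookup (1 + Poly_Mapping.single ?k (1::int)) 0 = 1"
    by (simp add: lookup_add lookup_single)
  then have "1 + Poly_Mapping.single ?k (1::int) \<noteq> 0" by (metis lookup_zero zero_neq_one)
  then have "to_fract (1 + Poly_Mapping.single ?k (1::int)) \<noteq> 0"
    by (simp only: to_fract_eq_0_iff not_False_eq_True)
  then show ?thesis
    by (simp add: beta_var_def indet_def mult_single flip: to_fract_mult)
qed

theorem theorem6: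
  fixes m :: nat
  assumes "m \<ge> 1"
  shows "(\<forall>w \<in> W_D (2 * m).
            double_groth_D beta_var (2 * m) w a_var b_var x_var =
              (\<Sum>J \<in> Rsub (2 * m) (Delta_D (2 * m)) w.
                 Wt_D beta_var (2 * m) a_var b_var x_var J)) \<and>
         (m \<ge> 2 \<longrightarrow>
           (\<forall>w \<in> W_D (2 * m - 1).
              double_groth_D beta_var (2 * m - 1) w a_var b_var x_var =
                (\<Sum>J \<in> Rsub (2 * m) (Delta_D (2 * m)) w.
                   Wt_D beta_var (2 * m) a_var b_var (x_var(2 * m := 0)) J)))"
proof -
  have b: "1 + beta_var * b_var i \<noteq> 0" and x: "1 + beta_var * x_var i \<noteq> 0" for i
    by (simp_all add: b_var_def x_var_def one_plus_beta_var)
  show ?thesis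
    by (intro conjI ballI impI double_groth_D_even[OF assms refl b x] double_groth_D_odd[OF _ b x])
qed

end
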